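(* Let $A$ be a subcomplex of a simplicial complex $X$ and let $r\ge 1$ be an integer. Suppose that the natural homomorphism $\tilde H_*(A)\to\tilde H_*(X)$ induced by inclusion is zero (in every degree) and that $\tilde H_*(A)$ is free abelian (in every degree). Then for every $n$, $$\tilde H_n(X\triangledown_A\overline{K}_r)\cong\tilde H_n(X)\oplus[\tilde H_{n-1}(A)]^r.$$
   Context: For a subcomplex $A$ of a simplicial complex $K$ and another simplicial complex $L$, $K\triangledown_A L$ (the join of $L$ and $K$ over $A$) is the simplicial complex whose vertex set is the disjoint union of the vertex sets of $K$ and $L$, and whose simplices are those of $K$, those of $L$, and the disjoint unions of a simplex of $A$ with a simplex of $L$. $\overline{K}_r$ is the discrete simplicial complex with $r$ vertices and no simplices of positive dimension. $\tilde H_n$ denotes reduced simplicial homology with integer coefficients (homology of the augmented simplicial chain complex; the empty complex has $\tilde H_{-1}=\mathbb{Z}$). $G^r$ is the direct sum of $r$ copies of $G$. *)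

theory Defs
  imports
    "HOL-Algebra.Free_Abelian_Groups"
    "HOL-Algebra.Exact_Sequence"
    "HOL-Combinatorics.Permutations"
begin

section \<open>Simplicial complexes and the join over a subcomplex\<close>

text \<open>
  A complex is given by its set of simplices, which are nonempty finite sets. Vertices are the
  elements of simplices, so a complex has no vertices beyond \<^term>\<open>\<Union>K\<close>, and the empty complex
  is \<^term>\<open>{}\<close>. Complexes may be infinite.
\<close>

definition abstract_simplicial_complex :: "'a set set \<Rightarrow> bool" where
  "abstract_simplicial_complex K \<longleftrightarrow>
     (\<forall>s\<in>K. finite s \<and> s \<noteq> {} \<and> (\<forall>t. t \<subseteq> s \<and> t \<noteq> {} \<longrightarrow> t \<in> K))"

definition subcomplex :: "'a set set \<Rightarrow> 'a set set \<Rightarrow> bool" where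
  "subcomplex A K \<longleftrightarrow> abstract_simplicial_complex A \<and> A \<subseteq> K"

definition join_over :: "'a set set \<Rightarrow> 'a set set \<Rightarrow> 'b set set \<Rightarrow> ('a + 'b) set set" where
  "join_over K A L = (`) Inl ` K \<union> (`) Inr ` L \<union> {s <+> t | s t. s \<in> A \<and> t \<in> L}"

definition discrete_complex :: "nat \<Rightarrow> nat set set" where
  "discrete_complex r = (\<lambda>i. {i}) ` {..<r}"

lemma abstract_simplicial_complex_discrete: "abstract_simplicial_complex (discrete_complex r)"
  by (auto simp: abstract_simplicial_complex_def discrete_complex_def subset_singleton_iff)

lemma abstract_simplicial_complex_join_over:
  assumes K: "abstract_simplicial_complex K" and A: "subcomplex A K"
    and L: "abstract_simplicial_complex L"
  shows "abstract_simplicial_complex (join_over K A L)"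
  unfolding abstract_simplicial_complex_def
proof (intro ballI conjI allI impI)
  fix u assume u: "u \<in> join_over K A L"
  have sub: "s \<in> K" if "s \<in> A" for s
    using that A by (auto simp: subcomplex_def)
  have K': "finite s" "s \<noteq> {}" "\<And>t. t \<subseteq> s \<Longrightarrow> t \<noteq> {} \<Longrightarrow> t \<in> K" if "s \<in> K" for s
    using that K unfolding abstract_simplicial_complex_def by blast+
  have A': "\<And>t. t \<subseteq> s \<Longrightarrow> t \<noteq> {} \<Longrightarrow> t \<in> A" if "s \<in> A" for s
    using that A unfolding abstract_simplicial_complex_def subcomplex_def by blast
  have L': "finite s" "s \<noteq> {}" "\<And>t. t \<subseteq> s \<Longrightarrow> t \<noteq> {} \<Longrightarrow> t \<in> L" if "s \<in> L" for s
    using that L unfolding abstract_simplicial_complex_def by blast+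
  show "finite u"
    using u K'(1) L'(1) sub by (auto simp: join_over_def)
  show "u \<noteq> {}"
    using u K'(2) L'(2) sub by (auto simp: join_over_def Plus_def)
  fix t assume t: "t \<subseteq> u \<and> t \<noteq> {}"
  define t1 where "t1 = Inl -` t"
  define t2 where "t2 = Inr -` t"
  have t_eq: "t = t1 <+> t2"
  proof (rule Set.set_eqI)
    show "z \<in> t \<longleftrightarrow> z \<in> t1 <+> t2" for z
      by (cases z) (auto simp: t1_def t2_def)
  qed
  have ne: "t1 \<noteq> {} \<or> t2 \<noteq> {}"
    using t t_eq by auto
  consider s where "s \<in> K" "u = Inl ` s" | s where "s \<in> L" "u = Inr ` s"
    | s s' where "s \<in> A" "s' \<in> L" "u = s <+> s'"
    using u by (auto simp: join_over_def)
  then have *: "(t1 \<noteq> {} \<longrightarrow> t1 \<in> K) \<and> (t2 \<noteq> {} \<longrightarrow> t2 \<in> L) \<and> (t1 \<noteq> {} \<and> t2 \<noteq> {} \<longrightarrow> t1 \<in> A)"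
  proof cases
    case 1
    then have "t1 \<subseteq> s" "t2 = {}" using t by (auto simp: t1_def t2_def)
    then show ?thesis using K'(3)[OF 1(1)] by blast
  next
    case 2
    then have "t2 \<subseteq> s" "t1 = {}" using t by (auto simp: t1_def t2_def)
    then show ?thesis using L'(3)[OF 2(1)] by blast
  next
    case 3
    then have "t1 \<subseteq> s" "t2 \<subseteq> s'" using t by (auto simp: t1_def t2_def)
    then show ?thesis using A'[OF 3(1)] L'(3)[OF 3(2)] sub by blast
  qed
  show "t \<in> join_over K A L"
  proof (cases "t1 = {} \<or> t2 = {}")
    case True
    then have "t = Inl ` t1 \<and> t1 \<noteq> {} \<or> t = Inr ` t2 \<and> t2 \<noteq> {}"
      using t_eq ne by (auto simp: Plus_def)
    then show ?thesis using * by (auto simp: join_over_def)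
  next
    case False
    then show ?thesis using * t_eq by (auto simp: join_over_def)
  qed
qed


section \<open>The augmented simplicial chain complex\<close>

text \<open>
  The list \<^term>\<open>xs\<close> stands for the oriented simplex [x0, ..., xn] of degree
  \<^term>\<open>int (length xs) - 1\<close>; the empty list is the generator of the augmentation term in degree -1.
  An oriented n-chain is a finitely supported integer-valued function on the oriented n-simplices
  that changes sign with the orientation.
\<close>

definition chain_group :: "int \<Rightarrow> 'a set set \<Rightarrow> ('a list \<Rightarrow> int) monoid" where
  "chain_group n K =
     \<lparr>carrier = {c. finite {xs. c xs \<noteq> 0} \<and>
                    (\<forall>xs. c xs \<noteq> 0 \<longrightarrow>
                       int (length xs) = n + 1 \<and> distinct xs \<and> set xs \<in> insert {} K) \<and>
                    (\<forall>xs p. p permutes {..<length xs} \<longrightarrow> c (permute_list p xs) = sign p * c xs)},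
      monoid.mult = (\<lambda>c d xs. c xs + d xs), one = (\<lambda>xs. 0)\<rparr>"

text \<open>
  The linear extension of [x0, ..., xn] \<open>\<mapsto>\<close> \<open>\<Sum>\<close>i. (-1)^i [x0, ..., xi omitted, ..., xn], and in
  degree 0 the augmentation. The formula holds because the oriented simplices having [ws] as a face
  are, up to orientation, the \<^term>\<open>v # ws\<close>, where it is the 0-th face; see
  \<open>boundary_oriented_simplex\<close> below.
\<close>

definition boundary :: "('a list \<Rightarrow> int) \<Rightarrow> 'a list \<Rightarrow> int" where
  "boundary c ws = (\<Sum>v | c (v # ws) \<noteq> 0. c (v # ws))"

text \<open>
  The elementary chain of [xs]: it takes the value 1 on \<^term>\<open>xs\<close> and the sign of \<open>p\<close> on its
  permutation by \<open>p\<close> (the sum has at most one summand when \<^term>\<open>xs\<close> is distinct).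
\<close>

definition oriented_simplex :: "'a list \<Rightarrow> 'a list \<Rightarrow> int" where
  "oriented_simplex xs ys =
     (\<Sum>p | p permutes {..<length xs} \<and> permute_list p xs = ys. sign p)"


section \<open>Reduced simplicial homology\<close>

definition cycle_group :: "int \<Rightarrow> 'a set set \<Rightarrow> ('a list \<Rightarrow> int) monoid" where
  "cycle_group n K =
     (chain_group n K)\<lparr>carrier := kernel (chain_group n K) (chain_group (n - 1) K) boundary\<rparr>"

definition boundaries :: "int \<Rightarrow> 'a set set \<Rightarrow> ('a list \<Rightarrow> int) set" where
  "boundaries n K = boundary ` carrier (chain_group (n + 1) K)"

definition reduced_homology_group :: "int \<Rightarrow> 'a set set \<Rightarrow> ('a list \<Rightarrow> int) set monoid" where
  "reduced_homology_group n K = cycle_group n K Mod boundaries n K"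

definition homology_class :: "int \<Rightarrow> 'a set set \<Rightarrow> ('a list \<Rightarrow> int) \<Rightarrow> ('a list \<Rightarrow> int) set" where
  "homology_class n K z = boundaries n K #>\<^bsub>cycle_group n K\<^esub> z"

text \<open>
  The map induced by the inclusion of a subcomplex \<open>A\<close> of \<open>X\<close>. Chains of \<open>A\<close> are chains of \<open>X\<close>, so
  it sends the class of a cycle in \<open>A\<close> to its class in \<open>X\<close>, that is, a coset of the boundaries of
  \<open>A\<close> to the coset of the boundaries of \<open>X\<close> containing it; see \<open>inclusion_induced_class\<close> below.
\<close>

definition inclusion_induced ::
    "int \<Rightarrow> 'a set set \<Rightarrow> ('a list \<Rightarrow> int) set \<Rightarrow> ('a list \<Rightarrow> int) set" where
  "inclusion_induced n X C = boundaries n X <#>\<^bsub>cycle_group n X\<^esub> C"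

text \<open>
  Taking \<open>S\<close> in the type of elements of \<open>G\<close> loses no generality: a basis is a subset of \<open>G\<close>.
\<close>

definition free_abelian :: "('a, 'm) monoid_scheme \<Rightarrow> bool" where
  "free_abelian G \<longleftrightarrow> (\<exists>S :: 'a set. G \<cong> free_Abelian_group S)"


section \<open>Well-definedness\<close>

lemma chain_group_simps [simp]:
  "c \<otimes>\<^bsub>chain_group n K\<^esub> d = (\<lambda>xs. c xs + d xs)" "\<one>\<^bsub>chain_group n K\<^esub> = (\<lambda>xs. 0)"
  by (auto simp: chain_group_def)

lemma in_chain_group:
  "c \<in> carrier (chain_group n K) \<longleftrightarrow>
     finite {xs. c xs \<noteq> 0} \<and>
     (\<forall>xs. c xs \<noteq> 0 \<longrightarrow> int (length xs) = n + 1 \<and> distinct xs \<and> set xs \<in> insert {} K) \<and>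
     (\<forall>xs p. p permutes {..<length xs} \<longrightarrow> c (permute_list p xs) = sign p * c xs)"
  by (simp add: chain_group_def)

lemma chain_group_finite: "c \<in> carrier (chain_group n K) \<Longrightarrow> finite {xs. c xs \<noteq> 0}"
  by (simp add: in_chain_group)

lemma chain_group_add:
  assumes "c \<in> carrier (chain_group n K)" "d \<in> carrier (chain_group n K)"
  shows "(\<lambda>xs. c xs + d xs) \<in> carrier (chain_group n K)"
proof -
  have "{xs. c xs + d xs \<noteq> 0} \<subseteq> {xs. c xs \<noteq> 0} \<union> {xs. d xs \<noteq> 0}"
    by auto
  then have "finite {xs. c xs + d xs \<noteq> 0}"
    using finite_subset finite_UnI[OF assms[THEN chain_group_finite]] by blast
  moreover have "int (length xs) = n + 1 \<and> distinct xs \<and> set xs \<in> insert {} K"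
    if "c xs + d xs \<noteq> 0" for xs
  proof -
    have "c xs \<noteq> 0 \<or> d xs \<noteq> 0" using that by auto
    then show ?thesis using assms unfolding in_chain_group by blast
  qed
  ultimately show ?thesis
    using assms unfolding in_chain_group by (auto simp: distrib_left)
qed

lemma chain_group_uminus:
  "c \<in> carrier (chain_group n K) \<Longrightarrow> (\<lambda>xs. - c xs) \<in> carrier (chain_group n K)"
  by (simp add: in_chain_group)

lemma comm_group_chain_group: "comm_group (chain_group n K)"
proof (rule comm_groupI, goal_cases)
  case (6 c)
  show ?case
    by (rule bexI[OF _ chain_group_uminus[OF 6]]) simp
qed (auto simp: chain_group_add in_chain_group[of "\<lambda>_. 0"])

lemma boundary_eq_sum:
  assumes "finite V" "\<And>v. c (v # ws) \<noteq> 0 \<Longrightarrow> v \<in> V"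
  shows "boundary c ws = (\<Sum>v\<in>V. c (v # ws))"
  unfolding boundary_def using assms by (intro sum.mono_neutral_left) auto

lemma boundary_zero [simp]: "boundary (\<lambda>_. 0) = (\<lambda>_. 0)"
  by (auto simp: boundary_def)

lemma finite_support_verts:
  assumes "finite {xs. c xs \<noteq> (0::int)}"
  obtains V where "finite V" "\<And>xs. c xs \<noteq> 0 \<Longrightarrow> set xs \<subseteq> V"
proof
  show "finite (\<Union>(set ` {xs. c xs \<noteq> 0}))"
    using assms by auto
qed auto

lemma boundary_add:
  assumes "finite {xs. c xs \<noteq> 0}" "finite {xs. d xs \<noteq> 0}"
  shows "boundary (\<lambda>xs. c xs + d xs) = (\<lambda>ws. boundary c ws + boundary d ws)"
proof
  fix ws
  obtain V where V: "finite V" "\<And>xs. c xs \<noteq> 0 \<Longrightarrow> set xs \<subseteq> V"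
    using finite_support_verts[OF assms(1)] by blast
  obtain W where W: "finite W" "\<And>xs. d xs \<noteq> 0 \<Longrightarrow> set xs \<subseteq> W"
    using finite_support_verts[OF assms(2)] by blast
  have fin: "finite (V \<union> W)" using V W by auto
  have c: "v \<in> V \<union> W" if "c (v # ws) \<noteq> 0" for v using V(2)[OF that] by auto
  have d: "v \<in> V \<union> W" if "d (v # ws) \<noteq> 0" for v using W(2)[OF that] by auto
  have cd: "v \<in> V \<union> W" if "c (v # ws) + d (v # ws) \<noteq> 0" for v
  proof -
    have "c (v # ws) \<noteq> 0 \<or> d (v # ws) \<noteq> 0" using that by auto
    then show ?thesis using c d by blast
  qed
  show "boundary (\<lambda>xs. c xs + d xs) ws = boundary c ws + boundary d ws"
    using boundary_eq_sum[of "V \<union> W" c ws] boundary_eq_sum[of "V \<union> W" d ws]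
      boundary_eq_sum[of "V \<union> W" "\<lambda>xs. c xs + d xs" ws] fin c d cd
    by (simp add: sum.distrib)
qed

lemma shift_permutation:
  assumes "p permutes {..<n}"
  shows "map_permutation {..<n} Suc p permutes {..<Suc n}"
    and "sign (map_permutation {..<n} Suc p) = sign p"
    and "map_permutation {..<n} Suc p 0 = 0"
    and "i < n \<Longrightarrow> map_permutation {..<n} Suc p (Suc i) = Suc (p i)"
proof -
  have "map_permutation {..<n} Suc p permutes (Suc ` {..<n})"
    by (rule map_permutation_permutes) (use assms in \<open>auto simp: bij_betw_def\<close>)
  then show "map_permutation {..<n} Suc p permutes {..<Suc n}"
    by (rule permutes_subset) auto
  show "sign (map_permutation {..<n} Suc p) = sign p"
    by (rule sign_map_permutation) (use assms in auto)
  show "map_permutation {..<n} Suc p 0 = 0"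
    by (auto simp: map_permutation_def restrict_id_def)
  show "map_permutation {..<n} Suc p (Suc i) = Suc (p i)" if "i < n"
    using that by (intro map_permutation_apply) auto
qed

lemma permute_list_shift:
  assumes "p permutes {..<length xs}"
  shows "permute_list (map_permutation {..<length xs} Suc p) (x # xs) = x # permute_list p xs"
proof (rule nth_equalityI)
  fix i assume "i < length (permute_list (map_permutation {..<length xs} Suc p) (x # xs))"
  then have "i < Suc (length xs)" by simp
  then show "permute_list (map_permutation {..<length xs} Suc p) (x # xs) ! i
      = (x # permute_list p xs) ! i"
    using shift_permutation[OF assms] assms
    by (cases i) (auto simp: permute_list_nth permute_list_def simp del: upt_Suc)
qed simp

lemma boundary_in_chain_group:
  assumes K: "abstract_simplicial_complex K" and c: "c \<in> carrier (chain_group n K)"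
  shows "boundary c \<in> carrier (chain_group (n - 1) K)"
proof -
  have ex: "\<exists>v. c (v # ws) \<noteq> 0" if "boundary c ws \<noteq> 0" for ws
    using that unfolding boundary_def by (metis (mono_tags, lifting) mem_Collect_eq sum.neutral)
  have "{ws. boundary c ws \<noteq> 0} \<subseteq> tl ` {xs. c xs \<noteq> 0}"
    using ex by force
  then have fin: "finite {ws. boundary c ws \<noteq> 0}"
    using finite_subset finite_imageI[OF chain_group_finite[OF c]] by blast
  have supp: "int (length ws) = n - 1 + 1 \<and> distinct ws \<and> set ws \<in> insert {} K"
    if nz: "boundary c ws \<noteq> 0" for ws
  proof -
    obtain v where "c (v # ws) \<noteq> 0" using ex[OF nz] by blast
    then have "int (length (v # ws)) = n + 1" "distinct (v # ws)" "set (v # ws) \<in> K"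
      using c by (auto simp: in_chain_group)
    moreover from this(3) have "set ws \<in> insert {} K"
      using K unfolding abstract_simplicial_complex_def
      by (metis insert_iff list.simps(15) set_subset_Cons)
    ultimately show ?thesis by simp
  qed
  have "boundary c (permute_list p ws) = sign p * boundary c ws"
    if p: "p permutes {..<length ws}" for p ws
  proof -
    have "c (v # permute_list p ws) = sign p * c (v # ws)" for v
      using c shift_permutation[OF p] permute_list_shift[OF p, of v]
      unfolding in_chain_group by (metis length_Cons)
    then show ?thesis
      by (simp add: boundary_def sum_distrib_left)
  qed
  then show ?thesis using fin supp unfolding in_chain_group by blast
qed

lemma chain_swap:
  assumes "c \<in> carrier (chain_group n K)"
  shows "c (u # v # ws) = - c (v # u # ws)"
proof -
  have p: "Transposition.transpose 0 1 permutes {..<length (v # u # ws)}"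
    by (rule permutes_swap_id) auto
  have "permute_list (Transposition.transpose 0 1) (v # u # ws) = u # v # ws"
  proof (rule nth_equalityI)
    fix i assume "i < length (permute_list (Transposition.transpose 0 1) (v # u # ws))"
    then have "i < length (v # u # ws)" by simp
    then show "permute_list (Transposition.transpose 0 1) (v # u # ws) ! i = (u # v # ws) ! i"
      by (subst permute_list_nth[OF p])
         (auto simp: Transposition.transpose_def nth_Cons split: nat.splits)
  qed simp
  then show ?thesis
    using assms p unfolding in_chain_group by (metis mult_minus1 sign_swap_id zero_neq_one)
qed

lemma boundary_boundary:
  assumes c: "c \<in> carrier (chain_group n K)"
  shows "boundary (boundary c) = (\<lambda>_. 0)"
proof
  fix ws
  obtain V where V: "finite V" "\<And>xs. c xs \<noteq> 0 \<Longrightarrow> set xs \<subseteq> V"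
    using finite_support_verts[of c] c unfolding in_chain_group by blast
  have b: "boundary c us = (\<Sum>v\<in>V. c (v # us))" for us
  proof (rule boundary_eq_sum)
    show "v \<in> V" if "c (v # us) \<noteq> 0" for v using V(2)[OF that] by auto
  qed (use V in auto)
  have bb: "boundary (boundary c) ws = (\<Sum>u\<in>V. boundary c (u # ws))"
  proof (rule boundary_eq_sum)
    show "u \<in> V" if nz: "boundary c (u # ws) \<noteq> 0" for u
    proof -
      obtain v where "c (v # u # ws) \<noteq> 0"
        using nz unfolding b by (meson sum.neutral)
      then show ?thesis using V(2) by fastforce
    qed
  qed (use V in auto)
  let ?S = "\<Sum>u\<in>V. \<Sum>v\<in>V. c (v # u # ws)"
  have "?S = (\<Sum>u\<in>V. \<Sum>v\<in>V. - c (u # v # ws))"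
    by (intro sum.cong refl chain_swap[OF c])
  also have "\<dots> = - (\<Sum>u\<in>V. \<Sum>v\<in>V. c (u # v # ws))"
    by (simp add: sum_negf)
  also have "\<dots> = - ?S"
    by (subst sum.swap) simp
  finally show "boundary (boundary c) ws = 0"
    by (simp add: bb b)
qed

lemma group_hom_boundary:
  assumes "abstract_simplicial_complex K"
  shows "group_hom (chain_group n K) (chain_group (n - 1) K) boundary"
proof -
  have "boundary \<in> hom (chain_group n K) (chain_group (n - 1) K)"
    using boundary_in_chain_group[OF assms]
    by (auto intro!: homI boundary_add dest: chain_group_finite)
  then show ?thesis
    by (simp add: group_hom_def group_hom_axioms_def comm_group.axioms comm_group_chain_group)
qed

lemma in_cycle_group:
  "z \<in> carrier (cycle_group n K) \<longleftrightarrow> z \<in> carrier (chain_group n K) \<and> boundary z = (\<lambda>_. 0)"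
  by (simp add: cycle_group_def kernel_def)

lemma cycle_group_simps [simp]:
  "c \<otimes>\<^bsub>cycle_group n K\<^esub> d = (\<lambda>xs. c xs + d xs)" "\<one>\<^bsub>cycle_group n K\<^esub> = (\<lambda>xs. 0)"
  by (auto simp: cycle_group_def)

lemma comm_group_cycle_group:
  assumes "abstract_simplicial_complex K"
  shows "comm_group (cycle_group n K)"
proof -
  interpret C: comm_group "chain_group n K" by (rule comm_group_chain_group)
  interpret B: group_hom "chain_group n K" "chain_group (n - 1) K" boundary
    by (rule group_hom_boundary[OF assms])
  show ?thesis
    unfolding cycle_group_def
    using subgroup.subgroup_is_group[OF B.subgroup_kernel C.is_group]
    by (rule group.group_comm_groupI) (simp add: add.commute)
qed

lemma subgroup_boundaries:
  assumes K: "abstract_simplicial_complex K"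
  shows "subgroup (boundaries n K) (cycle_group n K)"
proof -
  interpret Z: comm_group "cycle_group n K" by (rule comm_group_cycle_group[OF K])
  interpret B: group_hom "chain_group (n + 1) K" "chain_group n K" boundary
    using group_hom_boundary[OF K, of "n + 1"] by simp
  interpret D: group_hom "chain_group n K" "chain_group (n - 1) K" boundary
    by (rule group_hom_boundary[OF K])
  have "subgroup (boundaries n K) (chain_group n K)"
    unfolding boundaries_def by (rule B.img_is_subgroup)
  moreover have "boundaries n K \<subseteq> kernel (chain_group n K) (chain_group (n - 1) K) boundary"
    unfolding boundaries_def kernel_def by (auto simp: boundary_boundary)
  ultimately show ?thesis
    unfolding cycle_group_def by (intro B.H.subgroup_incl D.subgroup_kernel)
qed

lemma comm_group_reduced_homology_group:
  assumes "abstract_simplicial_complex K"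
  shows "comm_group (reduced_homology_group n K)"
  unfolding reduced_homology_group_def
  by (intro comm_group.abelian_FactGroup comm_group_cycle_group subgroup_boundaries assms)

lemma carrier_reduced_homology_group:
  "carrier (reduced_homology_group n K) = homology_class n K ` carrier (cycle_group n K)"
  by (simp add: reduced_homology_group_def carrier_FactGroup homology_class_def [abs_def])

lemma chain_group_mono:
  "A \<subseteq> X \<Longrightarrow> carrier (chain_group n A) \<subseteq> carrier (chain_group n X)"
  unfolding in_chain_group subset_iff by blast

lemma cycle_group_mono:
  "A \<subseteq> X \<Longrightarrow> carrier (cycle_group n A) \<subseteq> carrier (cycle_group n X)"
  using chain_group_mono[of A X n] unfolding in_cycle_group subset_iff by blast

lemma inclusion_induced_class:
  assumes X: "abstract_simplicial_complex X" and A: "subcomplex A X"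
    and z: "z \<in> carrier (cycle_group n A)"
  shows "inclusion_induced n X (homology_class n A z) = homology_class n X z"
proof -
  interpret Z: comm_group "cycle_group n X" by (rule comm_group_cycle_group[OF X])
  interpret B: subgroup "boundaries n X" "cycle_group n X" by (rule subgroup_boundaries[OF X])
  have A': "abstract_simplicial_complex A" "A \<subseteq> X" using A by (auto simp: subcomplex_def)
  have sub: "boundaries n A \<subseteq> boundaries n X"
    unfolding boundaries_def using chain_group_mono[OF A'(2)] by blast
  have z0: "(\<lambda>_. 0) \<in> boundaries n A"
    using subgroup.one_closed[OF subgroup_boundaries[OF A'(1)]] by simp
  show ?thesis
  proof
    show "inclusion_induced n X (homology_class n A z) \<subseteq> homology_class n X z"
    proof
      fix w assume "w \<in> inclusion_induced n X (homology_class n A z)"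
      then obtain b a where ba: "b \<in> boundaries n X" "a \<in> boundaries n A"
        "w = (\<lambda>xs. b xs + (a xs + z xs))"
        by (auto simp: inclusion_induced_def homology_class_def set_mult_def r_coset_def)
      have "(\<lambda>xs. b xs + a xs) \<in> boundaries n X"
        using B.m_closed[of b a] ba sub by auto
      then show "w \<in> homology_class n X z"
        unfolding homology_class_def r_coset_def ba(3) by (force simp: add.assoc)
    qed
    show "homology_class n X z \<subseteq> inclusion_induced n X (homology_class n A z)"
      using z0 by (force simp: inclusion_induced_def homology_class_def set_mult_def r_coset_def)
  qed
qed

lemma inclusion_induced_hom:
  assumes X: "abstract_simplicial_complex X" and A: "subcomplex A X"
  shows "inclusion_induced n X \<in> hom (reduced_homology_group n A) (reduced_homology_group n X)"
proof -
  have A': "abstract_simplicial_complex A" "A \<subseteq> X" using A by (auto simp: subcomplex_def)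
  have normal: "boundaries n K \<lhd> cycle_group n K" if "abstract_simplicial_complex K"
    for K :: "'a set set"
    using that by (simp add: comm_group.normal_iff_subgroup comm_group_cycle_group subgroup_boundaries)
  have mult: "homology_class n K y \<otimes>\<^bsub>reduced_homology_group n K\<^esub> homology_class n K z
      = homology_class n K (y \<otimes>\<^bsub>cycle_group n K\<^esub> z)"
    if "abstract_simplicial_complex K" "y \<in> carrier (cycle_group n K)"
      "z \<in> carrier (cycle_group n K)" for y z and K :: "'a set set"
    using normal.rcos_sum[OF normal[OF that(1)] that(2,3)]
    by (simp add: homology_class_def reduced_homology_group_def)
  have closed: "y \<otimes>\<^bsub>cycle_group n A\<^esub> z \<in> carrier (cycle_group n A)"
    if "y \<in> carrier (cycle_group n A)" "z \<in> carrier (cycle_group n A)" for y z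
    using that comm_group_cycle_group[OF A'(1)]
    by (meson comm_group.axioms(2) group.subgroup_self subgroup.m_closed)
  show ?thesis
  proof (rule homI)
    fix c assume "c \<in> carrier (reduced_homology_group n A)"
    then show "inclusion_induced n X c \<in> carrier (reduced_homology_group n X)"
      using subsetD[OF cycle_group_mono[OF A'(2)]] inclusion_induced_class[OF X A]
      by (auto simp: carrier_reduced_homology_group)
  next
    fix c d
    assume "c \<in> carrier (reduced_homology_group n A)" "d \<in> carrier (reduced_homology_group n A)"
    then obtain y z where yz: "y \<in> carrier (cycle_group n A)" "c = homology_class n A y"
      "z \<in> carrier (cycle_group n A)" "d = homology_class n A z"
      by (auto simp: carrier_reduced_homology_group)
    then have "y \<in> carrier (cycle_group n X)" "z \<in> carrier (cycle_group n X)"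
      using cycle_group_mono[OF A'(2)] by blast+
    then show "inclusion_induced n X (c \<otimes>\<^bsub>reduced_homology_group n A\<^esub> d)
        = inclusion_induced n X c \<otimes>\<^bsub>reduced_homology_group n X\<^esub> inclusion_induced n X d"
      using yz closed[OF yz(1,3)]
      by (simp add: mult[OF A'(1)] mult[OF X] inclusion_induced_class[OF X A])
  qed
qed


section \<open>The boundary of an oriented simplex\<close>

fun to_front :: "nat \<Rightarrow> nat \<Rightarrow> nat" where
  "to_front 0 = id"
| "to_front (Suc i) = Transposition.transpose i (Suc i) \<circ> to_front i"

lemma to_front_permutes: "i < n \<Longrightarrow> to_front i permutes {..<n}"
proof (induction i)
  case 0
  show ?case unfolding to_front.simps by (rule permutes_id)
next
  case (Suc i)
  then show ?case
    unfolding to_front.simps by (intro permutes_compose permutes_swap_id) auto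
qed

lemma to_front_0: "to_front i 0 = i"
  by (induction i) (auto simp: Transposition.transpose_def)

lemma sign_to_front: "sign (to_front i) = (-1) ^ i"
proof (induction i)
  case (Suc i)
  have "permutation (to_front i)"
    using to_front_permutes[of i "Suc i"] permutation_permutes by blast
  then show ?case
    unfolding to_front.simps using Suc
    by (subst sign_compose) (auto simp: permutation_swap_id sign_swap_id)
qed simp

lemma permute_list_to_front:
  "i < length xs \<Longrightarrow> permute_list (to_front i) xs = xs ! i # take i xs @ drop (Suc i) xs"
proof (induction i arbitrary: xs)
  case 0
  then show ?case by (cases xs) (auto simp flip: id_def)
next
  case (Suc i)
  let ?t = "Transposition.transpose i (Suc i)"
  let ?ys = "permute_list ?t xs"
  have t: "?t permutes {..<length xs}"
    using Suc.prems by (intro permutes_swap_id) auto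
  have nth: "?ys ! j = xs ! ?t j" if "j < length xs" for j
    by (rule permute_list_nth[OF t that])
  have "permute_list (to_front (Suc i)) xs = permute_list (to_front i) ?ys"
    unfolding to_front.simps
    by (rule permute_list_compose) (use Suc.prems to_front_permutes[of i "length xs"] in auto)
  also have "\<dots> = ?ys ! i # take i ?ys @ drop (Suc i) ?ys"
    using Suc.prems by (intro Suc.IH) simp
  also have "?ys ! i = xs ! Suc i"
    using Suc.prems by (simp add: nth)
  also have "take i ?ys = take i xs"
    by (rule nth_equalityI) (use Suc.prems in \<open>auto simp: nth Transposition.transpose_def\<close>)
  also have "drop (Suc i) ?ys = xs ! i # drop (Suc (Suc i)) xs"
  proof (rule nth_equalityI)
    fix j assume "j < length (drop (Suc i) ?ys)"
    then show "drop (Suc i) ?ys ! j = (xs ! i # drop (Suc (Suc i)) xs) ! j"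
      by (cases j) (auto simp: nth Transposition.transpose_def)
  qed (use Suc.prems in auto)
  finally show ?case
    using Suc.prems by (simp add: take_Suc_conv_app_nth)
qed

lemma boundary_oriented_simplex:
  "boundary (oriented_simplex xs) ws =
     (\<Sum>i<length xs. (-1) ^ i * oriented_simplex (take i xs @ drop (Suc i) xs) ws)"
proof (cases xs)
  case Nil
  then show ?thesis by (simp add: boundary_def oriented_simplex_def)
next
  case (Cons x xs')
  define m where "m = length xs'"
  have len: "length xs = Suc m" by (simp add: Cons m_def)
  define P where "P = {p. p permutes {..<Suc m}}"
  have finP: "finite P" unfolding P_def by (rule finite_permutations) simp
  let ?face = "\<lambda>i. take i xs @ drop (Suc i) xs"
  let ?sh = "map_permutation {..<m} Suc"
  have lenf: "length (?face i) = m" if "i < Suc m" for i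
    using that len by auto
  have hd: "permute_list p xs = xs ! p 0 # tl (permute_list p xs)" if "p \<in> P" for p
    using that len by (simp add: permute_list_def upt_conv_Cons del: upt_Suc)
  have "boundary (oriented_simplex xs) ws = (\<Sum>v\<in>set xs. oriented_simplex xs (v # ws))"
  proof (rule boundary_eq_sum)
    fix v assume "oriented_simplex xs (v # ws) \<noteq> 0"
    then obtain p where "p permutes {..<length xs}" "permute_list p xs = v # ws"
      unfolding oriented_simplex_def by (metis (mono_tags, lifting) mem_Collect_eq sum.neutral)
    then show "v \<in> set xs" by (metis list.set_intros(1) set_permute_list)
  qed simp
  also have "\<dots> = (\<Sum>v\<in>set xs. \<Sum>p | p \<in> P \<and> permute_list p xs = v # ws. sign p)"
    by (simp add: oriented_simplex_def P_def len)
  also have "\<dots> = (\<Sum>p | p \<in> P \<and> tl (permute_list p xs) = ws. sign p)"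
  proof (subst sum.UNION_disjoint [symmetric])
    have "(\<Union>v\<in>set xs. {p \<in> P. permute_list p xs = v # ws})
        = {p \<in> P. tl (permute_list p xs) = ws}" (is "?L = ?R")
    proof
      show "?R \<subseteq> ?L"
      proof
        fix p assume p: "p \<in> ?R"
        then have "p 0 < length xs"
          using permutes_in_image[of p "{..<Suc m}" 0] len by (auto simp: P_def)
        then have "xs ! p 0 \<in> set xs" by simp
        then show "p \<in> ?L" using p hd[of p] by auto
      qed
    qed auto
    then show "sum sign (\<Union>v\<in>set xs. {p \<in> P. permute_list p xs = v # ws})
        = (\<Sum>p | p \<in> P \<and> tl (permute_list p xs) = ws. sign p)"
      by simp
  qed (use finP in auto)
  also have "\<dots> = (\<Sum>i<Suc m. \<Sum>p | (p \<in> P \<and> tl (permute_list p xs) = ws) \<and> p 0 = i. sign p)"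
  proof -
    have "(\<lambda>p. p 0) ` {p. p \<in> P \<and> tl (permute_list p xs) = ws} \<subseteq> {..<Suc m}"
      using permutes_in_image[of _ "{..<Suc m}" 0] by (auto simp: P_def)
    from sum.group[OF _ _ this, of sign] show ?thesis
      using finP by simp
  qed
  also have "\<dots> = (\<Sum>i<Suc m. (-1) ^ i * oriented_simplex (?face i) ws)"
  proof (rule sum.cong)
    fix i assume "i \<in> {..<Suc m}"
    then have i: "i < Suc m" by simp
    let ?f = "to_front i"
    have f: "?f permutes {..<Suc m}" by (rule to_front_permutes[OF i])
    have pf: "permute_list (?f \<circ> ?sh q) xs = xs ! i # permute_list q (?face i)"
      if q: "q permutes {..<m}" for q
    proof -
      have "permute_list (?f \<circ> ?sh q) xs = permute_list (?sh q) (permute_list ?f xs)"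
        by (rule permute_list_compose) (use shift_permutation(1)[OF q] len in simp)
      also have "\<dots> = permute_list (?sh q) (xs ! i # ?face i)"
        using i len by (simp add: permute_list_to_front)
      also have "\<dots> = xs ! i # permute_list q (?face i)"
        using permute_list_shift[of q "?face i" "xs ! i"] q lenf[OF i] by simp
      finally show ?thesis .
    qed
    define unsh where "unsh = (\<lambda>p. map_permutation (Suc ` {..<m}) (\<lambda>n. n - 1) (inv_into UNIV ?f \<circ> p))"
    have fixing: "inv_into UNIV ?f \<circ> p permutes Suc ` {..<m}" if p: "p \<in> P" "p 0 = i" for p
    proof -
      have perm: "inv_into UNIV ?f \<circ> p permutes {..<Suc m}"
        using p f by (auto simp: P_def intro!: permutes_compose permutes_inv)
      have "(inv_into UNIV ?f \<circ> p) 0 = 0"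
        using p(2) to_front_0[of i] permutes_inverses(2)[OF f, of 0] by simp
      then show ?thesis
        by (intro permutes_superset[OF perm]) (auto simp: lessThan_Suc_eq_insert_0)
    qed
    have sh_unsh: "?sh (unsh p) = inv_into UNIV ?f \<circ> p" if p: "p \<in> P" "p 0 = i" for p
      unfolding unsh_def
      by (rule map_permutation_compose_inv[OF _ fixing[OF p]]) (auto simp: bij_betw_def inj_on_def image_image)
    have unsh_perm: "unsh p permutes {..<m}" if p: "p \<in> P" "p 0 = i" for p
      unfolding unsh_def
      by (rule map_permutation_permutes[OF _ fixing[OF p]])
         (auto simp: bij_betw_def inj_on_def image_image)
    have unsh_sh: "unsh (?f \<circ> ?sh q) = q" if q: "q permutes {..<m}" for q
    proof -
      have "inv_into UNIV ?f \<circ> (?f \<circ> ?sh q) = ?sh q"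
        using permutes_inv_o(2)[OF f] by (simp add: o_assoc)
      then show ?thesis
        unfolding unsh_def
        by (simp, intro map_permutation_compose_inv[OF _ q]) (auto simp: bij_betw_def inj_on_def)
    qed
    have f_unsh: "?f \<circ> ?sh (unsh p) = p" if p: "p \<in> P" "p 0 = i" for p
      using permutes_inv_o(1)[OF f] by (simp add: sh_unsh[OF p] o_assoc)
    have "(\<Sum>p | (p \<in> P \<and> tl (permute_list p xs) = ws) \<and> p 0 = i. sign p)
        = (\<Sum>q | q permutes {..<m} \<and> permute_list q (?face i) = ws. (-1) ^ i * sign q)"
    proof (rule sum.reindex_bij_witness[of _ "\<lambda>q. ?f \<circ> ?sh q" unsh])
      fix p assume "p \<in> {p. (p \<in> P \<and> tl (permute_list p xs) = ws) \<and> p 0 = i}"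
      then have p: "p \<in> P" "p 0 = i" "tl (permute_list p xs) = ws" by auto
      show "?f \<circ> ?sh (unsh p) = p" by (rule f_unsh[OF p(1,2)])
      show "unsh p \<in> {q. q permutes {..<m} \<and> permute_list q (?face i) = ws}"
        using unsh_perm[OF p(1,2)] pf[OF unsh_perm[OF p(1,2)]] f_unsh[OF p(1,2)] p(3) by simp
      have "sign (?f \<circ> ?sh (unsh p)) = sign ?f * sign (?sh (unsh p))"
        using f shift_permutation(1)[OF unsh_perm[OF p(1,2)]]
        by (intro sign_compose) (auto simp: permutation_permutes)
      then show "(-1) ^ i * sign (unsh p) = sign p"
        by (simp only: f_unsh[OF p(1,2)] sign_to_front shift_permutation(2)[OF unsh_perm[OF p(1,2)]])
    next
      fix q assume "q \<in> {q. q permutes {..<m} \<and> permute_list q (?face i) = ws}"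
      then have q: "q permutes {..<m}" "permute_list q (?face i) = ws" by auto
      show "unsh (?f \<circ> ?sh q) = q" by (rule unsh_sh[OF q(1)])
      show "?f \<circ> ?sh q \<in> {p. (p \<in> P \<and> tl (permute_list p xs) = ws) \<and> p 0 = i}"
        using f shift_permutation(1,3)[OF q(1)] pf[OF q(1)] q(2) to_front_0[of i]
        by (auto simp: P_def intro!: permutes_compose)
    qed
    then show "(\<Sum>p | (p \<in> P \<and> tl (permute_list p xs) = ws) \<and> p 0 = i. sign p)
        = (-1) ^ i * oriented_simplex (?face i) ws"
      by (simp only: oriented_simplex_def lenf[OF i] sum_distrib_left)
  qed simp
  finally show ?thesis by (simp only: len)
qed

end

theory Submission
  imports Defs
begin

text \<open>
  A simplex of the join \<open>Y\<close> of \<open>X\<close> with \<open>r\<close> points over \<open>A\<close> contains at most one of the new points.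
  So an \<open>n\<close>-chain of \<open>Y\<close> is the same thing as an \<open>n\<close>-chain \<open>x\<close> of \<open>X\<close> together with one
  \<open>(n-1)\<close>-chain \<open>a i\<close> of \<open>A\<close> for each new point \<open>i\<close>, namely the chain over which the cone with apex
  \<open>i\<close> is erected. In these coordinates the differential is
  \<open>(x, a) \<mapsto> (boundary x + (\<Sum>i. a i), - boundary (a i))\<close>,
  that is, the chain complex of \<open>Y\<close> is the mapping cone of the map from \<open>r\<close> copies of the chains of
  \<open>A\<close> to the chains of \<open>X\<close> (\<open>base_part_boundary\<close>, \<open>link_part_boundary\<close>, \<open>boundary_join_chain\<close>).

  As the inclusion of \<open>A\<close> is null in homology, the long exact sequence of this mapping cone breaks up
  into short ones, with \<open>H\<^sub>n(X)\<close> on the left and \<open>r\<close> copies of \<open>H\<^sub>n\<^sub>-\<^sub>1(A)\<close> on the right, and these split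
  because the right hand term is free abelian. The proof makes the splitting explicit instead of
  setting up the exact sequence. Every class of \<open>H\<^sub>n\<^sub>-\<^sub>1(A)\<close> is represented by a cycle that bounds a
  chain of \<open>X\<close>, and freeness allows these chains to be chosen additively: there is a homomorphism
  \<open>s\<close> from \<open>H\<^sub>n\<^sub>-\<^sub>1(A)\<close> to the \<open>n\<close>-chains of \<open>X\<close> such that \<open>boundary (s h)\<close> is a cycle of \<open>A\<close> in the
  class \<open>h\<close> (\<open>null_inclusion_section\<close>). A cycle \<open>z\<close> of \<open>X\<close> and classes \<open>h i\<close> then give the cycle
  \<open>(z - (\<Sum>i. s (h i)), boundary (s (h i)))\<close> of \<open>Y\<close>. Its class depends additively on \<open>z\<close> and \<open>h\<close>, it
  bounds exactly if \<open>z\<close> bounds and \<open>h\<close> vanishes, and every cycle of \<open>Y\<close> is homologous to one of this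
  form; so it defines the isomorphism.
\<close>

section \<open>Alternating functions on lists\<close>

text \<open>
  The induction step for \<open>alternating_if_swaps\<close>: a permutation first chooses which entry goes to the
  front and then permutes the others.
\<close>

lemma permutes_split_front:
  assumes p: "p permutes {..<Suc m}"
  obtains q where "q permutes {..<m}" "p = to_front (p 0) \<circ> map_permutation {..<m} Suc q"
proof -
  define k where "k = p 0"
  define f where "f = to_front k"
  have "p 0 \<in> {..<Suc m}"
    using permutes_in_image[OF p, of 0] by simp
  then have f: "f permutes {..<Suc m}"
    unfolding f_def k_def by (intro to_front_permutes) simp
  define g where "g = inv_into UNIV f \<circ> p"
  have "g 0 = inv_into UNIV f (f 0)"
    by (simp add: g_def f_def k_def to_front_0)
  then have g0: "g 0 = 0"
    using permutes_inverses(2)[OF f] by simp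
  have "g permutes {..<Suc m}"
    unfolding g_def by (rule permutes_compose[OF p permutes_inv[OF f]])
  then have g: "g permutes Suc ` {..<m}"
    by (rule permutes_superset) (auto simp: g0 lessThan_Suc_eq_insert_0)
  let ?q = "map_permutation (Suc ` {..<m}) (\<lambda>i. i - 1) g"
  have q: "?q permutes {..<m}"
    by (rule map_permutation_permutes[OF _ g]) (auto simp: bij_betw_def inj_on_def image_image)
  have "map_permutation {..<m} Suc ?q = g"
    by (rule map_permutation_compose_inv[OF _ g]) (auto simp: bij_betw_def inj_on_def image_image)
  moreover have "f \<circ> g = p"
    unfolding g_def o_assoc permutes_inv_o(1)[OF f] by simp
  ultimately have "p = to_front (p 0) \<circ> map_permutation {..<m} Suc ?q"
    by (simp only: f_def k_def)
  then show ?thesis by (rule that[OF q])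
qed

lemma move_to_front_if_swaps:
  fixes c :: "'a list \<Rightarrow> int"
  assumes "\<And>us u v ws. c (us @ u # v # ws) = - c (us @ v # u # ws)"
  shows "c (pre @ x # us @ vs) = (-1) ^ length us * c (pre @ us @ x # vs)"
proof (induction us arbitrary: pre)
  case (Cons u us)
  have "c (pre @ x # (u # us) @ vs) = - c ((pre @ [u]) @ x # us @ vs)"
    using assms[of pre x u "us @ vs"] by simp
  then show ?case
    using Cons.IH[of "pre @ [u]"] by simp
qed simp

text \<open>
  Adjacent transpositions generate the symmetric group, so for chains given by recursion over a list
  only the exchange of two neighbours has to be examined.
\<close>

lemma alternating_if_swaps:
  fixes c :: "'a list \<Rightarrow> int"
  assumes "\<And>us u v ws. c (us @ u # v # ws) = - c (us @ v # u # ws)"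
    and "p permutes {..<length xs}"
  shows "c (permute_list p xs) = sign p * c xs"
  using assms
proof (induction "length xs" arbitrary: c p xs)
  case 0
  have "xs = []"
    using 0(1) by simp
  moreover have "p = id"
    using 0(3) calculation by simp
  ultimately show ?case by simp
next
  case (Suc m)
  have p: "p permutes {..<Suc m}"
    using Suc.prems(2) Suc.hyps(2) by (simp only:)
  have "p 0 \<in> {..<Suc m}"
    using permutes_in_image[OF p, of 0] by simp
  then have i: "p 0 < length xs"
    using Suc.hyps(2) by simp
  obtain q where q: "q permutes {..<m}" and p_eq: "p = to_front (p 0) \<circ> map_permutation {..<m} Suc q"
    by (rule permutes_split_front[OF p])
  define i where "i = p 0"
  have i: "i < length xs" using i i_def by simp
  let ?x = "xs ! i" and ?face = "take i xs @ drop (Suc i) xs" and ?sh = "map_permutation {..<m} Suc q"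
  have m: "length ?face = m" using Suc.hyps(2) i by simp
  note sh = shift_permutation[OF q]
  have sign_p: "sign p = (-1) ^ i * sign q"
  proof -
    have "permutation (to_front i)" "permutation ?sh"
      using sh(1) to_front_permutes[OF i] permutation_permutes by blast+
    then have "sign (to_front i \<circ> ?sh) = sign (to_front i) * sign ?sh"
      by (rule sign_compose)
    then show ?thesis
      unfolding i_def p_eq[symmetric] by (simp only: sign_to_front sh(2))
  qed
  have "permute_list p xs = permute_list ?sh (permute_list (to_front i) xs)"
    unfolding i_def by (subst p_eq, rule permute_list_compose) (simp only: sh(1) Suc.hyps(2)[symmetric])
  also have "\<dots> = ?x # permute_list q ?face"
    unfolding permute_list_to_front[OF i] by (rule permute_list_shift[of q ?face ?x, unfolded m, OF q])
  finally have "c (permute_list p xs) = c (?x # permute_list q ?face)" by simp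
  also have "\<dots> = sign q * c (?x # ?face)"
  proof (rule Suc.hyps(1)[OF m[symmetric]])
    show "c (?x # us @ u # v # ws) = - c (?x # us @ v # u # ws)" for us u v ws
      using Suc.prems(1)[of "?x # us" u v ws] by simp
  qed (simp only: m q)
  \<comment> \<open>Moving the chosen entry back to its place costs the sign of \<open>to_front\<close>.\<close>
  also have "c (?x # ?face) = (-1) ^ i * c (take i xs @ ?x # drop (Suc i) xs)"
    using move_to_front_if_swaps[of c "[]" ?x "take i xs" "drop (Suc i) xs", OF Suc.prems(1)] i by simp
  also have "take i xs @ ?x # drop (Suc i) xs = xs"
    using i by (simp add: id_take_nth_drop[symmetric])
  finally show ?case by (simp add: sign_p)
qed

lemma chain_permute:
  "c \<in> carrier (chain_group n K) \<Longrightarrow> p permutes {..<length xs} \<Longrightarrow>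
     c (permute_list p xs) = sign p * c xs"
  by (simp add: in_chain_group)

lemma chain_move_to_front:
  assumes c: "c \<in> carrier (chain_group n K)"
  shows "c (x # us @ vs) = (-1) ^ length us * c (us @ x # vs)"
proof -
  let ?f = "to_front (length us)"
  have "permute_list ?f (us @ x # vs) = x # us @ vs"
    by (subst permute_list_to_front) auto
  moreover have "?f permutes {..<length (us @ x # vs)}"
    by (rule to_front_permutes) simp
  ultimately show ?thesis
    using chain_permute[OF c, of ?f "us @ x # vs"] by (simp only: sign_to_front)
qed

lemma chain_swap_within:
  assumes c: "c \<in> carrier (chain_group n K)"
  shows "c (us @ u # v # ws) = - c (us @ v # u # ws)"
proof -
  have two: "c (us @ x # y # ws) = c (x # y # us @ ws)" for x y
  proof -
    have "c (x # us @ y # ws) = (-1) ^ length us * c (us @ x # y # ws)"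
      by (rule chain_move_to_front[OF c])
    moreover have "c (y # x # us @ ws) = - ((-1) ^ length us * c (x # us @ y # ws))"
      using chain_move_to_front[OF c, of y "x # us" ws] by simp
    moreover have "c (x # y # us @ ws) = - c (y # x # us @ ws)"
      by (rule chain_swap[OF c])
    ultimately show ?thesis
      by (metis left_minus_one_mult_self minus_minus)
  qed
  show ?thesis
    unfolding two by (rule chain_swap[OF c])
qed

section \<open>Chains of the join as chains of its parts\<close>

text \<open>
  The chain with part \<open>x\<close> in the base complex and with the cone over \<open>a i\<close> at each apex \<open>i\<close>. The
  recursion moves the unique apex of an oriented simplex to the front, and each vertex passed over
  changes the sign; a list with a second apex gets the value 0.
\<close>

fun join_chain :: "('a list \<Rightarrow> int) \<Rightarrow> ('b \<Rightarrow> 'a list \<Rightarrow> int) \<Rightarrow> ('a + 'b) list \<Rightarrow> int" where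
  "join_chain x a [] = x []"
| "join_chain x a (Inl u # ys) = join_chain (\<lambda>ws. x (u # ws)) (\<lambda>i ws. - a i (u # ws)) ys"
| "join_chain x a (Inr i # ys) = (if ys \<in> lists (range Inl) then a i (map projl ys) else 0)"

lemma lists_range_Inl: "ys \<in> lists (range Inl) \<longleftrightarrow> (\<exists>ws. ys = map Inl ws)"
  using ex_map_conv[of ys Inl] by (auto simp: lists_eq_set image_iff subset_iff)

lemma join_chain_base [simp]: "join_chain x a (map Inl ws) = x ws"
  by (induction ws arbitrary: x a) auto

lemma join_chain_link [simp]: "join_chain x a (Inr i # map Inl ws) = a i ws"
  by (auto simp: lists_range_Inl comp_def)

lemma join_chain_nonzero:
  assumes "join_chain x a ys \<noteq> 0"
  shows "(\<exists>ws. ys = map Inl ws \<and> x ws \<noteq> 0) \<or>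
         (\<exists>us i vs. ys = map Inl us @ Inr i # map Inl vs \<and> a i (us @ vs) \<noteq> 0)"
  using assms
proof (induction x a ys rule: join_chain.induct)
  case (2 x a u ys)
  then have "(\<exists>ws. ys = map Inl ws \<and> x (u # ws) \<noteq> 0) \<or>
         (\<exists>us i vs. ys = map Inl us @ Inr i # map Inl vs \<and> - a i (u # us @ vs) \<noteq> 0)" by simp
  then show ?case
    by (metis (no_types, opaque_lifting) append_Cons list.simps(9) neg_equal_0_iff_equal)
next
  case (3 x a i ys)
  then obtain ws where "ys = map Inl ws" "a i ws \<noteq> 0"
    by (auto simp: lists_range_Inl comp_def split: if_splits)
  then show ?case
    by (metis append_Nil list.simps(8))
qed simp

lemma join_chain_add:
  "join_chain (\<lambda>ws. x ws + y ws) (\<lambda>i ws. a i ws + b i ws) ys = join_chain x a ys + join_chain y b ys"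
proof (induction x a ys arbitrary: y b rule: join_chain.induct)
  case (2 x a u ys)
  show ?case
    using 2[of "\<lambda>ws. y (u # ws)" "\<lambda>i ws. - b i (u # ws)"] by (simp add: algebra_simps)
qed auto

lemma join_chain_uminus:
  "join_chain (\<lambda>ws. - x ws) (\<lambda>i ws. - a i ws) ys = - join_chain x a ys"
  by (induction x a ys rule: join_chain.induct) auto

lemma join_chain_swap:
  assumes "\<And>us u v ws. x (us @ u # v # ws) = - x (us @ v # u # ws)"
    and "\<And>i us u v ws. a i (us @ u # v # ws) = - a i (us @ v # u # ws)"
  shows "join_chain x a (us @ u # v # ys) = - join_chain x a (us @ v # u # ys)"
  using assms
proof (induction us arbitrary: x a)
  case Nil
  note x = Nil(1)[of "[]", simplified] and a = Nil(2)[of _ "[]", simplified]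
  show ?case
  proof (cases u; cases v)
    fix u' v' assume "u = Inl u'" "v = Inl v'"
    then show ?thesis
      using join_chain_uminus[of "\<lambda>ws. x (v' # u' # ws)" "\<lambda>i ws. a i (v' # u' # ws)" ys]
        x[of u' v'] a[of _ u' v'] by simp
  qed auto
next
  case (Cons w us)
  show ?case
  proof (cases w)
    case (Inl w')
    have "join_chain (\<lambda>ws. x (w' # ws)) (\<lambda>i ws. - a i (w' # ws)) (us @ u # v # ys)
        = - join_chain (\<lambda>ws. x (w' # ws)) (\<lambda>i ws. - a i (w' # ws)) (us @ v # u # ys)"
    proof (rule Cons.IH)
      show "x (w' # us @ u # v # ws) = - x (w' # us @ v # u # ws)" for us u v ws
        using Cons.prems(1)[of "w' # us" u v ws] by simp
      show "- a i (w' # us @ u # v # ws) = - (- a i (w' # us @ v # u # ws))" for i us u v ws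
        using Cons.prems(2)[of i "w' # us" u v ws] by simp
    qed
    then show ?thesis using Inl by simp
  next
    case (Inr i)
    then show ?thesis using Cons.prems(2)[of i "map projl us" "projl u" "projl v" "map projl ys"] by simp
  qed
qed

lemma Inl_image_eq_iff:
  "(Inl ` s :: ('a + 'b) set) = Inl ` t \<longleftrightarrow> s = t"
  "insert (Inr i) (Inl ` s) \<noteq> (Inl ` t :: ('a + 'b) set)"
  "insert (Inr i) (Inl ` s) = (insert (Inr j) (Inl ` t) :: ('a + 'b) set) \<longleftrightarrow> i = j \<and> s = t"
proof -
  have vimage: "Inl -` (insert (Inr i) (Inl ` s)) = s" "Inr -` (insert (Inr i) (Inl ` s)) = {i}"
    for i :: 'b and s :: "'a set"
    by auto
  show "(Inl ` s :: ('a + 'b) set) = Inl ` t \<longleftrightarrow> s = t"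
    by (rule inj_image_eq_iff[OF inj_Inl])
  show "insert (Inr i) (Inl ` s) \<noteq> (Inl ` t :: ('a + 'b) set)"
    by auto
  show "insert (Inr i) (Inl ` s) = (insert (Inr j) (Inl ` t) :: ('a + 'b) set) \<longleftrightarrow> i = j \<and> s = t"
    using vimage[of i s] vimage[of j t] by (metis singleton_inject)
qed

text \<open>
  Admitting the empty face makes the bare apex \<open>i\<close> the cone over \<open>{}\<close>, so that it needs no separate
  case.
\<close>

lemma in_join_discrete:
  "s \<in> insert {} (join_over X A (discrete_complex r)) \<longleftrightarrow>
     (\<exists>t\<in>insert {} X. s = Inl ` t) \<or> (\<exists>t\<in>insert {} A. \<exists>i<r. s = insert (Inr i) (Inl ` t))"
proof -
  have P: "t <+> {i} = insert (Inr i) (Inl ` t)" for t :: "'a set" and i :: nat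
    by auto
  have "s \<in> (`) Inr ` discrete_complex r \<longleftrightarrow> (\<exists>i<r. s = {Inr i})"
    unfolding discrete_complex_def image_image by auto
  moreover have "s \<in> {t <+> u |t u. t \<in> A \<and> u \<in> discrete_complex r} \<longleftrightarrow> (\<exists>t\<in>A. \<exists>i<r. s = t <+> {i})"
    unfolding discrete_complex_def by blast
  ultimately have "s \<in> join_over X A (discrete_complex r) \<longleftrightarrow>
      (\<exists>t\<in>X. s = Inl ` t) \<or> (\<exists>i<r. s = {Inr i}) \<or> (\<exists>t\<in>A. \<exists>i<r. s = t <+> {i})"
    by (simp only: join_over_def Un_iff image_iff disj_assoc)
  moreover have "(\<exists>t\<in>insert {} X. s = Inl ` t) \<longleftrightarrow> s = {} \<or> (\<exists>t\<in>X. s = Inl ` t)"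
    by simp
  moreover have "(\<exists>t\<in>insert {} A. \<exists>i<r. s = insert (Inr i) (Inl ` t)) \<longleftrightarrow>
      (\<exists>i<r. s = {Inr i}) \<or> (\<exists>t\<in>A. \<exists>i<r. s = insert (Inr i) (Inl ` t))"
    by simp
  ultimately show ?thesis
    unfolding P by (simp only: insert_iff disj_assoc)
qed

lemma base_simplex_in_join:
  "Inl ` s \<in> insert {} (join_over X A (discrete_complex r)) \<longleftrightarrow> s \<in> insert {} X"
  unfolding in_join_discrete Inl_image_eq_iff Inl_image_eq_iff(2)[THEN not_sym, THEN eq_False[THEN iffD2]]
  by blast

lemma link_simplex_in_join:
  "insert (Inr i) (Inl ` s) \<in> insert {} (join_over X A (discrete_complex r)) \<longleftrightarrow> s \<in> insert {} A \<and> i < r"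
  unfolding in_join_discrete Inl_image_eq_iff by blast

lemma join_discrete_simplex_cases:
  assumes "set ys \<in> insert {} (join_over X A (discrete_complex r))" "distinct ys"
  obtains (base) ws where "ys = map Inl ws" "set ws \<in> insert {} X"
  | (link) us i vs where "ys = map Inl us @ Inr i # map Inl vs" "i < r" "set (us @ vs) \<in> insert {} A"
  using assms(1) unfolding in_join_discrete
proof (elim disjE bexE exE conjE)
  fix t assume t: "t \<in> insert {} X" "set ys = Inl ` t"
  then obtain ws where ws: "ys = map Inl ws"
    using lists_range_Inl[of ys] by auto
  then have "set ws = t"
    using t(2) by (simp add: inj_image_eq_iff)
  then show ?thesis
    using base[OF ws] t(1) by blast
next
  fix t i assume t: "t \<in> insert {} A" "i < r" "set ys = insert (Inr i) (Inl ` t)"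
  then obtain us' vs' where ys: "ys = us' @ Inr i # vs'"
    by (metis insertI1 split_list)
  have "Inr i \<notin> set us' \<union> set vs'" "insert (Inr i) (set us' \<union> set vs') = insert (Inr i) (Inl ` t)"
    using assms(2) t(3) by (auto simp: ys)
  then have eq: "set us' \<union> set vs' = Inl ` t"
    by (metis imageE insert_ident sum.distinct(2))
  then have "us' \<in> lists (range Inl)" "vs' \<in> lists (range Inl)"
    by auto
  then obtain us vs where uv: "us' = map Inl us" "vs' = map Inl vs"
    unfolding lists_range_Inl by blast
  have "Inl ` set (us @ vs) = (Inl ` t :: ('a + nat) set)"
    using eq by (simp add: uv image_Un)
  then have "set (us @ vs) = t"
    by (simp only: Inl_image_eq_iff)
  then show ?thesis
    using link[of us i vs] t(1,2) by (simp only: ys uv)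
qed

definition base_part :: "(('a + 'b) list \<Rightarrow> int) \<Rightarrow> 'a list \<Rightarrow> int" where
  "base_part c ws = c (map Inl ws)"

definition link_part :: "(('a + 'b) list \<Rightarrow> int) \<Rightarrow> 'b \<Rightarrow> 'a list \<Rightarrow> int" where
  "link_part c i ws = c (Inr i # map Inl ws)"

lemma parts_join_chain [simp]:
  "base_part (join_chain x a) = x" "link_part (join_chain x a) i = a i"
  by (simp_all add: base_part_def link_part_def fun_eq_iff del: join_chain.simps(3))

lemma chain_groupD:
  assumes "c \<in> carrier (chain_group n K)" "c xs \<noteq> 0"
  shows "int (length xs) = n + 1" "distinct xs" "set xs \<in> insert {} K"
  using assms unfolding in_chain_group by blast+

lemma join_chain_in_chain_group:
  assumes x: "x \<in> carrier (chain_group n X)"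
    and a: "\<And>i. i < r \<Longrightarrow> a i \<in> carrier (chain_group (n - 1) A)"
    and a0: "\<And>i. \<not> i < r \<Longrightarrow> a i = (\<lambda>_. 0)"
  shows "join_chain x a \<in> carrier (chain_group n (join_over X A (discrete_complex r)))"
proof -
  let ?Y = "join_over X A (discrete_complex r)"
  have supp: "int (length ys) = n + 1 \<and> distinct ys \<and> set ys \<in> insert {} ?Y"
    if "join_chain x a ys \<noteq> 0" for ys
    using join_chain_nonzero[OF that]
  proof (elim disjE exE conjE)
    fix ws assume ys: "ys = map Inl ws" and nz: "x ws \<noteq> 0"
    note D = chain_groupD[OF x nz]
    have "set ys \<in> insert {} ?Y"
      unfolding ys set_map base_simplex_in_join by (rule D(3))
    then show ?thesis
      using D(1,2) by (simp add: ys distinct_map)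
  next
    fix us i vs assume ys: "ys = map Inl us @ Inr i # map Inl vs" and nz: "a i (us @ vs) \<noteq> 0"
    have i: "i < r" using a0 nz by fastforce
    note D = chain_groupD[OF a[OF i] nz]
    have "set ys = insert (Inr i) (Inl ` set (us @ vs))"
      by (auto simp: ys)
    then have "set ys \<in> insert {} ?Y"
      using D(3) i link_simplex_in_join by metis
    moreover have "distinct ys"
      using D(2) by (auto simp: ys distinct_map)
    ultimately show ?thesis
      using D(1) by (simp add: ys)
  qed
  define V where "V = \<Union>(set ` {xs. x xs \<noteq> 0}) \<union> (\<Union>i<r. \<Union>(set ` {xs. a i xs \<noteq> 0}))"
  have V: "finite V"
    unfolding V_def using chain_group_finite[OF x] chain_group_finite[OF a] by auto
  have "set ys \<subseteq> Inl ` V \<union> Inr ` {..<r}" if "join_chain x a ys \<noteq> 0" for ys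
    using join_chain_nonzero[OF that]
  proof (elim disjE exE conjE)
    fix us i vs assume ys: "ys = map Inl us @ Inr i # map Inl vs" and nz: "a i (us @ vs) \<noteq> 0"
    have i: "i < r" using a0 nz by fastforce
    then have "set (us @ vs) \<subseteq> V" using nz unfolding V_def by blast
    then show ?thesis using i by (auto simp: ys)
  qed (auto simp: V_def)
  then have "{ys. join_chain x a ys \<noteq> 0} \<subseteq> {ys. set ys \<subseteq> Inl ` V \<union> Inr ` {..<r} \<and> length ys = nat (n + 1)}"
    using supp by fastforce
  then have "finite {ys. join_chain x a ys \<noteq> 0}"
    by (rule finite_subset) (intro finite_lists_length_eq finite_UnI finite_imageI V finite_lessThan)
  moreover have "join_chain x a (permute_list p ys) = sign p * join_chain x a ys"
    if "p permutes {..<length ys}" for p ys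
  proof (rule alternating_if_swaps[of "join_chain x a", OF _ that], rule join_chain_swap)
    show "x (us @ u # v # ws) = - x (us @ v # u # ws)" for us u v ws
      by (rule chain_swap_within[OF x])
    show "a i (us @ u # v # ws) = - a i (us @ v # u # ws)" for i us u v ws
    proof (cases "i < r")
      case True
      then show ?thesis by (rule chain_swap_within[OF a])
    next
      case False
      then show ?thesis by (simp add: a0)
    qed
  qed
  ultimately show ?thesis
    unfolding in_chain_group using supp by blast
qed

lemma chain_join_Inr_nonzero:
  assumes "c \<in> carrier (chain_group n (join_over X A (discrete_complex r)))" "c (Inr i # ys) \<noteq> 0"
  obtains ws where "ys = map Inl ws" "i < r" "set ws \<in> insert {} A"
proof -
  note D = chain_groupD[OF assms]
  show ?thesis
  proof (rule join_discrete_simplex_cases[OF D(3,2)])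
    fix us j vs
    assume "Inr i # ys = map Inl us @ Inr j # map Inl vs" "j < r" "set (us @ vs) \<in> insert {} A"
    then show ?thesis using that[of vs] by (cases us) auto
  qed (use that in \<open>auto simp: Cons_eq_map_conv\<close>)
qed

text \<open>
  A simplex of the join has at most one apex, and alternation determines the value of a chain from its
  value after the apex has been moved to the front.
\<close>

lemma chain_join_eqI:
  assumes c: "c \<in> carrier (chain_group n (join_over X A (discrete_complex r)))"
    and d: "d \<in> carrier (chain_group n (join_over X A (discrete_complex r)))"
    and base: "base_part c = base_part d"
    and link: "\<And>i. i < r \<Longrightarrow> link_part c i = link_part d i"
  shows "c = d"
proof
  fix ys
  show "c ys = d ys"
  proof (cases "c ys = 0 \<and> d ys = 0")
    case False
    then have simplex: "set ys \<in> insert {} (join_over X A (discrete_complex r))" "distinct ys"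
      using chain_groupD[OF c] chain_groupD[OF d] by blast+
    show ?thesis
    proof (rule join_discrete_simplex_cases[OF simplex])
      fix ws assume "ys = map Inl ws"
      then show ?thesis
        using fun_cong[OF base, of ws] by (simp add: base_part_def)
    next
      fix us i vs assume ys: "ys = map Inl us @ Inr i # map Inl vs" and i: "i < r"
      have "c (Inr i # map Inl us @ map Inl vs) = d (Inr i # map Inl us @ map Inl vs)"
        using fun_cong[OF link[OF i], of "us @ vs"] by (simp add: link_part_def)
      then show ?thesis
        unfolding ys chain_move_to_front[OF c] chain_move_to_front[OF d] by simp
    qed
  qed simp
qed

lemma base_part_in_chain_group:
  assumes c: "c \<in> carrier (chain_group n (join_over X A (discrete_complex r)))"
  shows "base_part c \<in> carrier (chain_group n X)"
proof -
  have "finite (map Inl -` {ys. c ys \<noteq> 0})"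
    by (intro finite_vimageI chain_group_finite[OF c] inj_mapI inj_Inl)
  moreover have "int (length ws) = n + 1 \<and> distinct ws \<and> set ws \<in> insert {} X"
    if "c (map Inl ws) \<noteq> 0" for ws
  proof -
    note D = chain_groupD[OF c that]
    have "set ws \<in> insert {} X"
      using D(3) unfolding set_map base_simplex_in_join .
    then show ?thesis using D(1,2) by (simp add: distinct_map)
  qed
  moreover have "c (map Inl (permute_list p ws)) = sign p * c (map Inl ws)"
    if "p permutes {..<length ws}" for p ws
    using chain_permute[OF c, of p "map Inl ws"] that by (simp add: permute_list_map)
  ultimately show ?thesis
    unfolding in_chain_group base_part_def by (simp add: vimage_def)
qed

lemma link_part_in_chain_group:
  assumes c: "c \<in> carrier (chain_group n (join_over X A (discrete_complex r)))"
  shows "link_part c i \<in> carrier (chain_group (n - 1) A)"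
proof -
  have "inj (\<lambda>ws. Inr i # map Inl ws)"
    by (auto simp: inj_def)
  then have "finite ((\<lambda>ws. Inr i # map Inl ws) -` {ys. c ys \<noteq> 0})"
    by (intro finite_vimageI chain_group_finite[OF c])
  moreover have "int (length ws) = n \<and> distinct ws \<and> set ws \<in> insert {} A"
    if nz: "c (Inr i # map Inl ws) \<noteq> 0" for ws
  proof -
    note D = chain_groupD[OF c nz]
    have "set ws \<in> insert {} A"
      by (rule chain_join_Inr_nonzero[OF c nz]) (simp add: inj_map_eq_map)
    then show ?thesis using D(1,2) by (simp add: distinct_map)
  qed
  moreover have "c (Inr i # map Inl (permute_list p ws)) = sign p * c (Inr i # map Inl ws)"
    if p: "p permutes {..<length ws}" for p ws
  proof -
    have p': "p permutes {..<length (map Inl ws :: ('a + nat) list)}"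
      using p by simp
    show ?thesis
      using chain_permute[OF c, of "map_permutation {..<length ws} Suc p" "Inr i # map Inl ws"]
        permute_list_shift[OF p', of "Inr i"] shift_permutation(1,2)[OF p] p
      by (simp add: permute_list_map)
  qed
  ultimately show ?thesis
    unfolding in_chain_group link_part_def by (simp add: vimage_def)
qed

text \<open>
  Besides the simplices of \<open>X\<close>, the cones over a simplex of \<open>A\<close> have that simplex as a face, opposite
  to the apex. As the apex comes first, its sign is \<open>+\<close>.
\<close>

lemma base_part_boundary:
  assumes c: "c \<in> carrier (chain_group n (join_over X A (discrete_complex r)))"
  shows "base_part (boundary c) = (\<lambda>ws. boundary (base_part c) ws + (\<Sum>i<r. link_part c i ws))"
proof
  fix ws
  define V where "V = {u. c (Inl u # map Inl ws) \<noteq> 0}"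
  have "inj (\<lambda>u. Inl u # map Inl ws)"
    by (auto simp: inj_def)
  then have "finite ((\<lambda>u. Inl u # map Inl ws) -` {ys. c ys \<noteq> 0})"
    by (intro finite_vimageI chain_group_finite[OF c])
  then have V: "finite V" by (simp add: V_def vimage_def)
  have "boundary c (map Inl ws) = (\<Sum>v \<in> Inl ` V \<union> Inr ` {..<r}. c (v # map Inl ws))"
  proof (rule boundary_eq_sum)
    fix v assume nz: "c (v # map Inl ws) \<noteq> 0"
    show "v \<in> Inl ` V \<union> Inr ` {..<r}"
    proof (cases v)
      case (Inr i)
      then show ?thesis using chain_join_Inr_nonzero[OF c, of i "map Inl ws"] nz by blast
    qed (use nz in \<open>simp add: V_def\<close>)
  qed (use V in simp)
  also have "\<dots> = (\<Sum>v \<in> Inl ` V. c (v # map Inl ws)) + (\<Sum>v \<in> Inr ` {..<r}. c (v # map Inl ws))"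
    using V by (intro sum.union_disjoint) auto
  also have "\<dots> = (\<Sum>u\<in>V. c (Inl u # map Inl ws)) + (\<Sum>i<r. c (Inr i # map Inl ws))"
    by (simp add: sum.reindex inj_on_def)
  finally show "base_part (boundary c) ws = boundary (base_part c) ws + (\<Sum>i<r. link_part c i ws)"
    by (simp add: base_part_def link_part_def V_def boundary_def[of "base_part c"])
qed

text \<open>
  A vertex added to a cone must be a vertex of \<open>A\<close>, since no simplex has two apices. It comes before
  the apex, and exchanging the two accounts for the sign.
\<close>

lemma link_part_boundary:
  assumes c: "c \<in> carrier (chain_group n (join_over X A (discrete_complex r)))"
  shows "link_part (boundary c) i = (\<lambda>ws. - boundary (link_part c i) ws)"
proof
  fix ws
  define V where "V = {u. c (Inl u # Inr i # map Inl ws) \<noteq> 0}"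
  have "inj (\<lambda>u. Inl u # Inr i # map Inl ws)"
    by (auto simp: inj_def)
  then have "finite ((\<lambda>u. Inl u # Inr i # map Inl ws) -` {ys. c ys \<noteq> 0})"
    by (intro finite_vimageI chain_group_finite[OF c])
  then have V: "finite V" by (simp add: V_def vimage_def)
  have swap: "c (Inl u # Inr i # map Inl ws) = - link_part c i (u # ws)" for u
    using chain_swap[OF c, of "Inl u" "Inr i"] by (simp add: link_part_def)
  have "boundary c (Inr i # map Inl ws) = (\<Sum>v \<in> Inl ` V. c (v # Inr i # map Inl ws))"
  proof (rule boundary_eq_sum)
    fix v assume nz: "c (v # Inr i # map Inl ws) \<noteq> 0"
    show "v \<in> Inl ` V"
    proof (cases v)
      case (Inr j)
      then obtain us where "Inr i # map Inl ws = map Inl us"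
        using chain_join_Inr_nonzero[OF c] nz by blast
      then show ?thesis by (auto simp: Cons_eq_map_conv)
    qed (use nz in \<open>simp add: V_def\<close>)
  qed (use V in simp)
  also have "\<dots> = (\<Sum>u\<in>V. c (Inl u # Inr i # map Inl ws))"
    by (simp add: sum.reindex inj_on_def)
  also have "\<dots> = - boundary (link_part c i) ws"
    by (simp add: V_def swap boundary_def sum_negf)
  finally show "link_part (boundary c) i ws = - boundary (link_part c i) ws"
    by (simp add: link_part_def[of "boundary c"])
qed

section \<open>Additive choice of bounding chains\<close>

text \<open>
  Free abelian groups are projective: lift a basis along \<open>p\<close> and extend linearly. Two homomorphisms
  that agree on a basis agree everywhere.
\<close>

lemma free_abelian_section:
  fixes H :: "('h, 'm) monoid_scheme"
  assumes free: "free_abelian H" and H: "group H" and G: "comm_group G"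
    and p: "p \<in> hom G H" and surj: "p ` carrier G = carrier H"
  obtains s where "s \<in> hom H G" "\<And>h. h \<in> carrier H \<Longrightarrow> p (s h) = h"
proof -
  interpret H: group H by (rule H)
  interpret G: comm_group G by (rule G)
  obtain S :: "'h set" and \<phi> where \<phi>: "\<phi> \<in> iso H (free_Abelian_group S)"
    using free by (auto simp: free_abelian_def is_iso_def)
  let ?F = "free_Abelian_group S"
  define \<psi> where "\<psi> = inv_into (carrier H) \<phi>"
  have \<psi>: "\<psi> \<in> hom ?F H"
    using H.iso_set_sym[OF \<phi>] by (simp add: \<psi>_def iso_def)
  have \<psi>\<phi>: "\<psi> (\<phi> h) = h" if "h \<in> carrier H" for h
    using \<phi> that by (simp add: \<psi>_def iso_def bij_betw_def)
  have \<phi>_hom: "\<phi> \<in> hom H ?F"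
    using \<phi> by (simp add: iso_def)
  have "\<exists>g\<in>carrier G. p g = \<psi> (frag_of x)" if "x \<in> S" for x
  proof -
    have "\<psi> (frag_of x) \<in> carrier H"
      using that by (intro hom_in_carrier[OF \<psi>]) simp
    then show ?thesis using surj by (metis imageE)
  qed
  then obtain g where g: "\<And>x. x \<in> S \<Longrightarrow> g x \<in> carrier G" "\<And>x. x \<in> S \<Longrightarrow> p (g x) = \<psi> (frag_of x)"
    by metis
  have "g ` S \<subseteq> carrier G"
    using g(1) by blast
  then obtain k where k: "k \<in> hom ?F G" "\<And>x. x \<in> S \<Longrightarrow> k (frag_of x) = g x"
    by (rule G.free_Abelian_group_universal) blast
  interpret pk: group_hom ?F H "p \<circ> k"
    using hom_compose[OF k(1) p] by (simp add: group_hom_def group_hom_axioms_def H)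
  interpret psi: group_hom ?F H \<psi>
    using \<psi> by (simp add: group_hom_def group_hom_axioms_def H)
  have pk: "p (k u) = \<psi> u" if "Poly_Mapping.keys u \<subseteq> S" for u
    using that
  proof (rule free_Abelian_group_induct)
    show "p (k 0) = \<psi> 0"
      using pk.hom_one psi.hom_one by simp
    show "p (k (u - v)) = \<psi> (u - v)"
      if uv: "Poly_Mapping.keys u \<subseteq> S" "Poly_Mapping.keys v \<subseteq> S" "p (k u) = \<psi> u" "p (k v) = \<psi> v" for u v
      using pk.hom_mult[of u "- v"] psi.hom_mult[of u "- v"] pk.hom_inv[of v] psi.hom_inv[of v] uv
      by simp
    show "p (k (frag_of x)) = \<psi> (frag_of x)" if "x \<in> S" for x
      by (simp add: k(2) g(2) that)
  qed
  show ?thesis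
  proof
    show "k \<circ> \<phi> \<in> hom H G"
      by (rule hom_compose[OF \<phi>_hom k(1)])
    show "p ((k \<circ> \<phi>) h) = h" if "h \<in> carrier H" for h
    proof -
      have "Poly_Mapping.keys (\<phi> h) \<subseteq> S"
        using hom_in_carrier[OF \<phi>_hom that] by simp
      then show ?thesis
        by (simp add: pk \<psi>\<phi> that)
    qed
  qed
qed

lemma sum_lessThan_closed:
  fixes f :: "nat \<Rightarrow> 'x \<Rightarrow> int"
  assumes "(\<lambda>_. 0) \<in> S" "\<And>c d. c \<in> S \<Longrightarrow> d \<in> S \<Longrightarrow> (\<lambda>xs. c xs + d xs) \<in> S"
    and "\<And>i. i < r \<Longrightarrow> f i \<in> S"
  shows "(\<lambda>xs. \<Sum>i<r. f i xs) \<in> S"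
  using assms(3)
proof (induction r)
  case (Suc r)
  then show ?case
    using assms(2)[of "\<lambda>xs. \<Sum>i<r. f i xs" "f r"] by simp
qed (simp add: assms(1))

lemma chain_group_zero: "(\<lambda>_. 0) \<in> carrier (chain_group n K)"
  by (simp add: in_chain_group)

lemma chain_group_sum:
  fixes r :: nat
  assumes "\<And>i. i < r \<Longrightarrow> f i \<in> carrier (chain_group n K)"
  shows "(\<lambda>xs. \<Sum>i<r. f i xs) \<in> carrier (chain_group n K)"
  by (intro sum_lessThan_closed chain_group_zero chain_group_add assms)

lemma boundary_uminus: "boundary (\<lambda>xs. - c xs) = (\<lambda>ws. - boundary c ws)"
  by (simp add: boundary_def sum_negf fun_eq_iff)

lemma boundary_chain_add:
  assumes "c \<in> carrier (chain_group n K)" "d \<in> carrier (chain_group n K)"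
  shows "boundary (\<lambda>xs. c xs + d xs) = (\<lambda>ws. boundary c ws + boundary d ws)"
  using assms by (intro boundary_add chain_group_finite)

lemma boundary_chain_sum:
  fixes r :: nat
  assumes "\<And>i. i < r \<Longrightarrow> f i \<in> carrier (chain_group n K)"
  shows "boundary (\<lambda>xs. \<Sum>i<r. f i xs) = (\<lambda>ws. \<Sum>i<r. boundary (f i) ws)"
  using assms
proof (induction r)
  case (Suc r)
  then have "boundary (\<lambda>xs. (\<Sum>i<r. f i xs) + f r xs) = (\<lambda>ws. boundary (\<lambda>xs. \<Sum>i<r. f i xs) ws + boundary (f r) ws)"
    by (intro boundary_chain_add[of _ n K] chain_group_sum) auto
  then show ?case
    using Suc by simp
qed simp

lemma homology_class_mult:
  assumes K: "abstract_simplicial_complex K"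
    and "y \<in> carrier (cycle_group n K)" "z \<in> carrier (cycle_group n K)"
  shows "homology_class n K y \<otimes>\<^bsub>reduced_homology_group n K\<^esub> homology_class n K z
      = homology_class n K (\<lambda>xs. y xs + z xs)"
proof -
  have "boundaries n K \<lhd> cycle_group n K"
    using K by (simp add: comm_group.normal_iff_subgroup comm_group_cycle_group subgroup_boundaries)
  from normal.rcos_sum[OF this assms(2,3)] show ?thesis
    by (simp add: homology_class_def reduced_homology_group_def)
qed

lemma homology_class_eq_iff:
  assumes K: "abstract_simplicial_complex K"
    and y: "y \<in> carrier (cycle_group n K)" and z: "z \<in> carrier (cycle_group n K)"
  shows "homology_class n K y = homology_class n K z \<longleftrightarrow> (\<lambda>xs. y xs - z xs) \<in> boundaries n K"
proof -
  interpret Z: comm_group "cycle_group n K" by (rule comm_group_cycle_group[OF K])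
  interpret B: subgroup "boundaries n K" "cycle_group n K" by (rule subgroup_boundaries[OF K])
  have "(\<lambda>xs. - z xs) \<in> carrier (cycle_group n K)"
    using z by (simp add: in_cycle_group chain_group_uminus boundary_uminus)
  then have inv: "inv\<^bsub>cycle_group n K\<^esub> z = (\<lambda>xs. - z xs)"
    using z by (intro Z.inv_equality) auto
  have "homology_class n K y = homology_class n K z \<longleftrightarrow> y \<in> homology_class n K z"
    unfolding homology_class_def
    using Z.repr_independence[of y "boundaries n K" z] Z.rcos_self[of y "boundaries n K"]
      B.subgroup_axioms y z by auto
  also have "\<dots> \<longleftrightarrow> (\<lambda>xs. y xs - z xs) \<in> boundaries n K"
    unfolding homology_class_def using B.rcos_module[OF Z.group_axioms z y] by (simp add: inv)
  finally show ?thesis .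
qed

lemma homology_class_zero:
  assumes K: "abstract_simplicial_complex K"
  shows "homology_class n K (\<lambda>_. 0) = \<one>\<^bsub>reduced_homology_group n K\<^esub>"
proof -
  interpret Z: comm_group "cycle_group n K" by (rule comm_group_cycle_group[OF K])
  have "boundaries n K #>\<^bsub>cycle_group n K\<^esub> \<one>\<^bsub>cycle_group n K\<^esub> = boundaries n K"
    using subgroup.subset[OF subgroup_boundaries[OF K]] by (rule Z.coset_mult_one)
  then show ?thesis
    by (simp add: homology_class_def reduced_homology_group_def FactGroup_def)
qed

lemma cycle_group_zero: "(\<lambda>_. 0) \<in> carrier (cycle_group n K)"
  by (simp add: in_cycle_group chain_group_zero)

lemma homology_class_eq_one_iff:
  assumes K: "abstract_simplicial_complex K" and z: "z \<in> carrier (cycle_group n K)"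
  shows "homology_class n K z = \<one>\<^bsub>reduced_homology_group n K\<^esub> \<longleftrightarrow> z \<in> boundaries n K"
  using homology_class_eq_iff[OF K z cycle_group_zero] by (simp add: homology_class_zero[OF K])

lemma cycle_group_add:
  assumes "y \<in> carrier (cycle_group n K)" "z \<in> carrier (cycle_group n K)"
  shows "(\<lambda>xs. y xs + z xs) \<in> carrier (cycle_group n K)"
  using assms unfolding in_cycle_group
  by (auto simp: chain_group_add boundary_chain_add)

text \<open>
  Consider the group \<open>R\<close> of those chains of \<open>X\<close> whose boundary is a cycle of \<open>A\<close>. Sending such a chain
  to the class of its boundary is a homomorphism onto the homology of \<open>A\<close>: every cycle of \<open>A\<close> bounds in
  \<open>X\<close> because the inclusion is null. Freeness provides a section.
\<close>

lemma null_inclusion_section: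
  assumes X: "abstract_simplicial_complex X" and A: "subcomplex A X"
    and null: "trivial_homomorphism (reduced_homology_group k A) (reduced_homology_group k X)
                 (inclusion_induced k X)"
    and free: "free_abelian (reduced_homology_group k A)"
  obtains s where "s \<in> hom (reduced_homology_group k A) (chain_group (k + 1) X)"
    and "\<And>h. h \<in> carrier (reduced_homology_group k A) \<Longrightarrow> boundary (s h) \<in> carrier (cycle_group k A)"
    and "\<And>h. h \<in> carrier (reduced_homology_group k A) \<Longrightarrow> homology_class k A (boundary (s h)) = h"
proof -
  have A': "abstract_simplicial_complex A" "A \<subseteq> X"
    using A by (auto simp: subcomplex_def)
  interpret C: comm_group "chain_group (k + 1) X" by (rule comm_group_chain_group)
  define R where "R = {x \<in> carrier (chain_group (k + 1) X). boundary x \<in> carrier (cycle_group k A)}"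
  let ?G = "(chain_group (k + 1) X)\<lparr>carrier := R\<rparr>"
  have R_add: "(\<lambda>xs. x xs + y xs) \<in> R" if "x \<in> R" "y \<in> R" for x y
    using that by (auto simp: R_def chain_group_add boundary_chain_add cycle_group_add)
  have "subgroup R (chain_group (k + 1) X)"
  proof (rule C.subgroupI)
    have "(\<lambda>_. 0) \<in> R"
      by (simp add: R_def chain_group_zero cycle_group_zero)
    then show "R \<noteq> {}" by blast
    show "inv\<^bsub>chain_group (k + 1) X\<^esub> x \<in> R" if x: "x \<in> R" for x
    proof -
      have "x \<in> carrier (chain_group (k + 1) X)"
        using x by (simp add: R_def)
      then have "inv\<^bsub>chain_group (k + 1) X\<^esub> x = (\<lambda>xs. - x xs)"
        by (intro C.inv_equality) (auto simp: chain_group_uminus)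
      moreover have "(\<lambda>xs. - x xs) \<in> R"
        using x by (auto simp: R_def chain_group_uminus boundary_uminus in_cycle_group)
      ultimately show ?thesis by simp
    qed
  qed (use R_add in \<open>auto simp: R_def\<close>)
  then have "group ?G"
    by (rule subgroup.subgroup_is_group) (rule C.is_group)
  then have G: "comm_group ?G"
    by (rule group.group_comm_groupI) (simp add: add.commute)
  let ?p = "\<lambda>x. homology_class k A (boundary x)"
  have p: "?p \<in> hom ?G (reduced_homology_group k A)"
  proof (rule homI)
    show "?p x \<in> carrier (reduced_homology_group k A)" if "x \<in> carrier ?G" for x
      using that by (auto simp: R_def carrier_reduced_homology_group)
    show "?p (x \<otimes>\<^bsub>?G\<^esub> y) = ?p x \<otimes>\<^bsub>reduced_homology_group k A\<^esub> ?p y"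
      if "x \<in> carrier ?G" "y \<in> carrier ?G" for x y
      using that by (simp add: R_def homology_class_mult[OF A'(1)] boundary_chain_add[of _ "k + 1" X])
  qed
  have "?p ` carrier ?G = carrier (reduced_homology_group k A)"
  proof
    show "?p ` carrier ?G \<subseteq> carrier (reduced_homology_group k A)"
      using p by (auto simp: hom_def)
    show "carrier (reduced_homology_group k A) \<subseteq> ?p ` carrier ?G"
    proof
      fix h assume h: "h \<in> carrier (reduced_homology_group k A)"
      then obtain z where z: "z \<in> carrier (cycle_group k A)" "h = homology_class k A z"
        by (auto simp: carrier_reduced_homology_group)
      have zX: "z \<in> carrier (cycle_group k X)"
        using z(1) cycle_group_mono[OF A'(2)] by blast
      have "homology_class k X z = \<one>\<^bsub>reduced_homology_group k X\<^esub>"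
        using null h inclusion_induced_class[OF X A z(1)] z(2) by (simp add: trivial_homomorphism_def)
      then have "z \<in> boundaries k X"
        using homology_class_eq_one_iff[OF X zX] by blast
      then obtain x where "x \<in> carrier (chain_group (k + 1) X)" "z = boundary x"
        by (auto simp: boundaries_def)
      then show "h \<in> ?p ` carrier ?G"
        using z by (auto simp: R_def)
    qed
  qed
  moreover have "group (reduced_homology_group k A)"
    using comm_group_reduced_homology_group[OF A'(1)] by (rule comm_group.axioms(2))
  ultimately obtain s where s: "s \<in> hom (reduced_homology_group k A) ?G"
    "\<And>h. h \<in> carrier (reduced_homology_group k A) \<Longrightarrow> ?p (s h) = h"
    using free_abelian_section[OF free _ G p] by metis
  have sR: "s h \<in> R" if "h \<in> carrier (reduced_homology_group k A)" for h
    using hom_in_carrier[OF s(1) that] by simp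
  show ?thesis
  proof
    show "s \<in> hom (reduced_homology_group k A) (chain_group (k + 1) X)"
      using s(1) by (auto simp: hom_def R_def Pi_def)
  qed (use sR s(2) in \<open>auto simp: R_def\<close>)
qed

section \<open>The cycles of the join\<close>

lemma join_chain_zero [simp]: "join_chain (\<lambda>_. 0) (\<lambda>_ _. 0) = (\<lambda>_. 0)"
proof
  show "join_chain (\<lambda>_. 0) (\<lambda>_ _. 0) ys = 0" for ys :: "('a + 'b) list"
    using join_chain_add[of "\<lambda>_. 0" "\<lambda>_. 0" "\<lambda>_ _. 0" "\<lambda>_ _. 0" ys] by simp
qed

text \<open>
  The differential of the mapping cone of the inclusion of \<open>r\<close> copies of the chains of \<open>A\<close> into the
  chains of \<open>X\<close>. The sign is forced by the apex being the 0-th vertex of a cone.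
\<close>

lemma boundary_join_chain:
  fixes r :: nat
  assumes X: "abstract_simplicial_complex X" and A: "subcomplex A X"
    and x: "x \<in> carrier (chain_group n X)"
    and a: "\<And>i. i < r \<Longrightarrow> a i \<in> carrier (chain_group (n - 1) A)"
    and a0: "\<And>i. \<not> i < r \<Longrightarrow> a i = (\<lambda>_. 0)"
  shows "boundary (join_chain x a)
      = join_chain (\<lambda>ws. boundary x ws + (\<Sum>i<r. a i ws)) (\<lambda>i ws. - boundary (a i) ws)"
proof (rule chain_join_eqI)
  have A': "abstract_simplicial_complex A" "A \<subseteq> X"
    using A by (auto simp: subcomplex_def)
  let ?Y = "join_over X A (discrete_complex r)"
  have Y: "abstract_simplicial_complex ?Y"
    by (intro abstract_simplicial_complex_join_over X A abstract_simplicial_complex_discrete)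
  have c: "join_chain x a \<in> carrier (chain_group n ?Y)"
    by (rule join_chain_in_chain_group[OF x a a0])
  show "boundary (join_chain x a) \<in> carrier (chain_group (n - 1) ?Y)"
    by (rule boundary_in_chain_group[OF Y c])
  show "join_chain (\<lambda>ws. boundary x ws + (\<Sum>i<r. a i ws)) (\<lambda>i ws. - boundary (a i) ws)
      \<in> carrier (chain_group (n - 1) ?Y)"
    using chain_group_mono[OF A'(2)]
    by (intro join_chain_in_chain_group chain_group_add boundary_in_chain_group[OF X x]
        chain_group_sum chain_group_uminus boundary_in_chain_group[OF A'(1)])
      (use a in \<open>auto simp: a0\<close>)
  show "base_part (boundary (join_chain x a))
      = base_part (join_chain (\<lambda>ws. boundary x ws + (\<Sum>i<r. a i ws)) (\<lambda>i ws. - boundary (a i) ws))"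
    by (simp add: base_part_boundary[OF c])
  show "link_part (boundary (join_chain x a)) i
      = link_part (join_chain (\<lambda>ws. boundary x ws + (\<Sum>i<r. a i ws)) (\<lambda>i ws. - boundary (a i) ws)) i" for i
    by (simp add: link_part_boundary[OF c])
qed

text \<open>
  Here \<open>s\<close> is the section supplied by \<open>null_inclusion_section\<close>. The cone with apex \<open>i\<close> over the cycle
  \<open>boundary (s h)\<close> has that same cycle as its boundary, so subtracting \<open>s h\<close> from it closes it up to a
  cycle of the join. Such a cycle is the suspension of the class \<open>h\<close> by the \<open>i\<close>-th vertex, and it is
  additive in \<open>h\<close> because \<open>s\<close> is.
\<close>

locale bounded_subcomplex_cycles =
  fixes X A :: "'a set set" and n :: int and s :: "('a list \<Rightarrow> int) set \<Rightarrow> 'a list \<Rightarrow> int" and r :: nat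
  assumes X: "abstract_simplicial_complex X" and A: "subcomplex A X"
    and null: "trivial_homomorphism (reduced_homology_group n A) (reduced_homology_group n X)
                 (inclusion_induced n X)"
    and s: "s \<in> hom (reduced_homology_group (n - 1) A) (chain_group n X)"
    and s_cycle: "\<And>h. h \<in> carrier (reduced_homology_group (n - 1) A) \<Longrightarrow>
                   boundary (s h) \<in> carrier (cycle_group (n - 1) A)"
    and s_class: "\<And>h. h \<in> carrier (reduced_homology_group (n - 1) A) \<Longrightarrow>
                   homology_class (n - 1) A (boundary (s h)) = h"
begin

abbreviation Y :: "('a + nat) set set" where
  "Y \<equiv> join_over X A (discrete_complex r)"

abbreviation HA :: "('a list \<Rightarrow> int) set monoid" where
  "HA \<equiv> reduced_homology_group (n - 1) A"

abbreviation HAr :: "(nat \<Rightarrow> ('a list \<Rightarrow> int) set) monoid" where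
  "HAr \<equiv> sum_group {..<r} (\<lambda>_. HA)"

text \<open>
  A family of classes has no meaningful value outside \<open>{..<r}\<close>, where a chain of the join has zero
  links.
\<close>

definition suspension_link :: "(nat \<Rightarrow> ('a list \<Rightarrow> int) set) \<Rightarrow> nat \<Rightarrow> 'a list \<Rightarrow> int" where
  "suspension_link h i = (if i < r then boundary (s (h i)) else (\<lambda>_. 0))"

definition suspended_cycle ::
    "('a list \<Rightarrow> int) \<Rightarrow> (nat \<Rightarrow> ('a list \<Rightarrow> int) set) \<Rightarrow> ('a + nat) list \<Rightarrow> int" where
  "suspended_cycle z h = join_chain (\<lambda>ws. z ws - (\<Sum>i<r. s (h i) ws)) (suspension_link h)"

lemma A_complex: "abstract_simplicial_complex A" and A_subset: "A \<subseteq> X"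
  using A by (auto simp: subcomplex_def)

lemma Y_complex: "abstract_simplicial_complex Y"
  by (intro abstract_simplicial_complex_join_over X A abstract_simplicial_complex_discrete)

lemma group_HA: "group HA"
  using comm_group_reduced_homology_group[OF A_complex] by (rule comm_group.axioms(2))

lemma group_HAr: "group HAr"
  by (rule sum_group) (rule group_HA)

lemma carrier_HAr: "h \<in> carrier HAr \<longleftrightarrow> h \<in> {..<r} \<rightarrow>\<^sub>E carrier HA"
  using group_HA by (simp add: carrier_sum_group)

lemma in_HA: "h \<in> carrier HAr \<Longrightarrow> i < r \<Longrightarrow> h i \<in> carrier HA"
  using carrier_HAr by auto

lemma s_chain: "h \<in> carrier HA \<Longrightarrow> s h \<in> carrier (chain_group n X)"
  by (rule hom_in_carrier[OF s])

lemma s_add: "h \<in> carrier HA \<Longrightarrow> h' \<in> carrier HA \<Longrightarrow> s (h \<otimes>\<^bsub>HA\<^esub> h') = (\<lambda>ws. s h ws + s h' ws)"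
  using hom_mult[OF s, of h h'] by simp

lemma s_one: "s \<one>\<^bsub>HA\<^esub> = (\<lambda>_. 0)"
  using hom_one[OF s group_HA] comm_group.axioms(2)[OF comm_group_chain_group, of n X] by simp

lemma suspension_link_in_chain_group:
  "h \<in> carrier HAr \<Longrightarrow> i < r \<Longrightarrow> suspension_link h i \<in> carrier (chain_group (n - 1) A)"
  using s_cycle[OF in_HA] by (simp add: suspension_link_def in_cycle_group)

lemma sum_s_in_chain_group:
  "h \<in> carrier HAr \<Longrightarrow> (\<lambda>ws. \<Sum>i<r. s (h i) ws) \<in> carrier (chain_group n X)"
  by (intro chain_group_sum s_chain in_HA)

lemma suspended_base_in_chain_group:
  assumes "z \<in> carrier (cycle_group n X)" "h \<in> carrier HAr"
  shows "(\<lambda>ws. z ws - (\<Sum>i<r. s (h i) ws)) \<in> carrier (chain_group n X)"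
  using chain_group_add[OF _ chain_group_uminus[OF sum_s_in_chain_group[OF assms(2)]], of z] assms(1)
  by (simp add: in_cycle_group)

lemma suspended_cycle_in_cycle_group:
  assumes z: "z \<in> carrier (cycle_group n X)" and h: "h \<in> carrier HAr"
  shows "suspended_cycle z h \<in> carrier (cycle_group n Y)"
proof -
  have chain: "suspended_cycle z h \<in> carrier (chain_group n Y)"
    unfolding suspended_cycle_def
    using suspended_base_in_chain_group[OF z h] suspension_link_in_chain_group[OF h]
    by (rule join_chain_in_chain_group) (simp_all add: suspension_link_def)
  have "boundary (\<lambda>ws. z ws - (\<Sum>i<r. s (h i) ws)) = (\<lambda>ws. - (\<Sum>i<r. boundary (s (h i)) ws))"
  proof -
    have "boundary (\<lambda>ws. z ws + - (\<Sum>i<r. s (h i) ws))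
        = (\<lambda>ws. boundary z ws + boundary (\<lambda>ws. - (\<Sum>i<r. s (h i) ws)) ws)"
      using z sum_s_in_chain_group[OF h]
      by (intro boundary_chain_add[of _ n X] chain_group_uminus) (auto simp: in_cycle_group)
    also have "boundary (\<lambda>ws. - (\<Sum>i<r. s (h i) ws)) = (\<lambda>ws. - (\<Sum>i<r. boundary (s (h i)) ws))"
      unfolding boundary_uminus using h
      by (subst boundary_chain_sum[of r _ n X]) (auto intro: s_chain in_HA)
    finally show ?thesis using z by (simp add: in_cycle_group)
  qed
  moreover have "boundary (suspension_link h i) = (\<lambda>_. 0)" for i
    using s_cycle[OF in_HA[OF h]] by (simp add: suspension_link_def in_cycle_group)
  moreover have "boundary (suspended_cycle z h)
      = join_chain (\<lambda>ws. boundary (\<lambda>ws. z ws - (\<Sum>i<r. s (h i) ws)) ws + (\<Sum>i<r. suspension_link h i ws))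
          (\<lambda>i ws. - boundary (suspension_link h i) ws)"
    unfolding suspended_cycle_def
    using suspended_base_in_chain_group[OF z h] suspension_link_in_chain_group[OF h]
    by (rule boundary_join_chain[OF X A]) (simp_all add: suspension_link_def)
  ultimately have "boundary (suspended_cycle z h) = join_chain (\<lambda>_. 0) (\<lambda>_ _. 0)"
    by (simp add: suspension_link_def)
  then show ?thesis
    using chain by (simp add: in_cycle_group)
qed

lemma suspended_cycle_add:
  assumes h: "h \<in> carrier HAr" "h' \<in> carrier HAr"
  shows "suspended_cycle (\<lambda>ws. z ws + z' ws) (h \<otimes>\<^bsub>HAr\<^esub> h')
      = (\<lambda>ys. suspended_cycle z h ys + suspended_cycle z' h' ys)"
proof
  fix ys
  have "suspension_link (h \<otimes>\<^bsub>HAr\<^esub> h') = (\<lambda>i ws. suspension_link h i ws + suspension_link h' i ws)"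
  proof
    fix i
    show "suspension_link (h \<otimes>\<^bsub>HAr\<^esub> h') i = (\<lambda>ws. suspension_link h i ws + suspension_link h' i ws)"
      using in_HA[OF h(1), of i] in_HA[OF h(2), of i]
      by (simp add: suspension_link_def s_add boundary_chain_add[of _ n X] s_chain)
  qed
  moreover have "(\<Sum>i<r. s ((h \<otimes>\<^bsub>HAr\<^esub> h') i) ws) = (\<Sum>i<r. s (h i) ws) + (\<Sum>i<r. s (h' i) ws)" for ws
    using in_HA[OF h(1)] in_HA[OF h(2)] by (simp add: s_add sum.distrib)
  ultimately show "suspended_cycle (\<lambda>ws. z ws + z' ws) (h \<otimes>\<^bsub>HAr\<^esub> h') ys
      = suspended_cycle z h ys + suspended_cycle z' h' ys"
    unfolding suspended_cycle_def join_chain_add[symmetric] by (simp add: algebra_simps)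
qed

text \<open>
  Let a chain with parts \<open>y\<close> and \<open>b i\<close> bound the cycle. Comparing links, \<open>- b i\<close> is a chain of \<open>A\<close>
  bounding \<open>boundary (s (h i))\<close>, whose class is \<open>h i\<close>; so \<open>h\<close> vanishes and each \<open>b i\<close> is a cycle of
  \<open>A\<close>. Comparing bases, \<open>z\<close> is the boundary of \<open>y\<close> plus the cycles \<open>b i\<close>, and these bound in \<open>X\<close>
  because the inclusion is null in degree \<open>n\<close> too.
\<close>

lemma suspended_cycle_boundary_imp:
  assumes z: "z \<in> carrier (cycle_group n X)" and h: "h \<in> carrier HAr"
    and bd: "suspended_cycle z h \<in> boundaries n Y"
  shows "z \<in> boundaries n X" "h = \<one>\<^bsub>HAr\<^esub>"
proof -
  obtain d where d: "d \<in> carrier (chain_group (n + 1) Y)" "suspended_cycle z h = boundary d"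
    using bd by (auto simp: boundaries_def)
  define y where "y = base_part d"
  define b where "b = link_part d"
  have y: "y \<in> carrier (chain_group (n + 1) X)"
    unfolding y_def by (rule base_part_in_chain_group[OF d(1)])
  have b: "b i \<in> carrier (chain_group n A)" for i
    unfolding b_def using link_part_in_chain_group[OF d(1), of i] by simp
  have link_eq: "boundary (s (h i)) = (\<lambda>ws. - boundary (b i) ws)" if "i < r" for i
    using link_part_boundary[OF d(1), of i] d(2)[symmetric] that
    by (simp add: b_def suspended_cycle_def suspension_link_def)
  have base_eq: "(\<lambda>ws. z ws - (\<Sum>i<r. s (h i) ws)) = (\<lambda>ws. boundary y ws + (\<Sum>i<r. b i ws))"
    using base_part_boundary[OF d(1)] d(2)[symmetric] by (simp add: y_def b_def suspended_cycle_def)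
  have h_one: "h i = \<one>\<^bsub>HA\<^esub>" if i: "i < r" for i
  proof -
    have "boundary (s (h i)) = boundary (\<lambda>ws. - b i ws)"
      by (simp add: boundary_uminus link_eq[OF i])
    moreover have "(\<lambda>ws. - b i ws) \<in> carrier (chain_group (n - 1 + 1) A)"
      using chain_group_uminus[OF b] by simp
    ultimately have "boundary (s (h i)) \<in> boundaries (n - 1) A"
      unfolding boundaries_def by (rule image_eqI)
    then show ?thesis
      using homology_class_eq_one_iff[OF A_complex s_cycle[OF in_HA[OF h i]]] s_class[OF in_HA[OF h i]]
      by simp
  qed
  then show "h = \<one>\<^bsub>HAr\<^esub>"
    using h carrier_HAr by (intro ext) (auto simp: PiE_def extensional_def)
  interpret B: subgroup "boundaries n X" "cycle_group n X" by (rule subgroup_boundaries[OF X])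
  have "b i \<in> boundaries n X" if i: "i < r" for i
  proof -
    have "boundary (b i) = (\<lambda>_. 0)"
      using link_eq[OF i] by (simp add: h_one[OF i] s_one fun_eq_iff)
    then have bi: "b i \<in> carrier (cycle_group n A)"
      using b by (simp add: in_cycle_group)
    have "homology_class n A (b i) \<in> carrier (reduced_homology_group n A)"
      using bi by (simp add: carrier_reduced_homology_group)
    then have "homology_class n X (b i) = \<one>\<^bsub>reduced_homology_group n X\<^esub>"
      using null inclusion_induced_class[OF X A bi] by (auto simp: trivial_homomorphism_def)
    then show ?thesis
      using homology_class_eq_one_iff[OF X] cycle_group_mono[OF A_subset] bi by blast
  qed
  then have "(\<lambda>ws. \<Sum>i<r. b i ws) \<in> boundaries n X"
    using B.one_closed B.m_closed by (intro sum_lessThan_closed) auto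
  moreover have "boundary y \<in> boundaries n X"
    using y by (auto simp: boundaries_def)
  ultimately have "(\<lambda>ws. boundary y ws + (\<Sum>i<r. b i ws)) \<in> boundaries n X"
    using B.m_closed by fastforce
  moreover have "z = (\<lambda>ws. boundary y ws + (\<Sum>i<r. b i ws))"
    using base_eq by (simp add: h_one s_one)
  ultimately show "z \<in> boundaries n X" by simp
qed

lemma suspended_cycle_of_boundary:
  assumes "z \<in> boundaries n X"
  shows "suspended_cycle z \<one>\<^bsub>HAr\<^esub> \<in> boundaries n Y"
proof -
  obtain y where y: "y \<in> carrier (chain_group (n + 1) X)" "z = boundary y"
    using assms by (auto simp: boundaries_def)
  have "suspension_link \<one>\<^bsub>HAr\<^esub> = (\<lambda>_ _. 0)"
    by (auto simp: suspension_link_def s_one fun_eq_iff)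
  then have "suspended_cycle z \<one>\<^bsub>HAr\<^esub> = boundary (join_chain y (\<lambda>_ _. 0))"
    using boundary_join_chain[OF X A y(1), of r "\<lambda>_ _. 0"]
    by (simp add: suspended_cycle_def s_one chain_group_zero y(2))
  moreover have "join_chain y (\<lambda>_ _. 0) \<in> carrier (chain_group (n + 1) Y)"
    using y(1) by (intro join_chain_in_chain_group) (auto simp: chain_group_zero)
  ultimately show ?thesis
    by (simp add: boundaries_def)
qed

text \<open>
  The links \<open>a i\<close> of a cycle of the join are cycles of \<open>A\<close>, and their classes \<open>h i\<close> tell which
  suspensions to use. Since \<open>a i\<close> differs from \<open>boundary (s (h i))\<close> by the boundary of a chain \<open>b i\<close>
  of \<open>A\<close>, the boundary of the cones over the \<open>b i\<close> carries the cycle to a suspended one, moving the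
  \<open>b i\<close> into the base.
\<close>

lemma homologous_suspended_cycle:
  assumes c: "c \<in> carrier (cycle_group n Y)"
  obtains z h where "z \<in> carrier (cycle_group n X)" "h \<in> carrier HAr"
    "homology_class n Y c = homology_class n Y (suspended_cycle z h)"
proof -
  have cY: "c \<in> carrier (chain_group n Y)" and c0: "boundary c = (\<lambda>_. 0)"
    using c by (auto simp: in_cycle_group)
  define y where "y = base_part c"
  define a where "a = link_part c"
  have y: "y \<in> carrier (chain_group n X)"
    unfolding y_def by (rule base_part_in_chain_group[OF cY])
  have a: "a i \<in> carrier (chain_group (n - 1) A)" for i
    unfolding a_def by (rule link_part_in_chain_group[OF cY])
  have zero_parts: "base_part (\<lambda>_. 0) = (\<lambda>_. 0)" "link_part (\<lambda>_. 0) i = (\<lambda>_. 0)" for i :: nat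
    by (auto simp: base_part_def link_part_def)
  have "boundary (a i) = (\<lambda>_. 0)" for i
    using link_part_boundary[OF cY, of i] by (simp add: c0 zero_parts a_def fun_eq_iff)
  then have a_cycle: "a i \<in> carrier (cycle_group (n - 1) A)" for i
    using a by (simp add: in_cycle_group)
  have sum_zero: "boundary y ws + (\<Sum>i<r. a i ws) = 0" for ws
    using fun_cong[OF base_part_boundary[OF cY], of ws] by (simp add: c0 zero_parts a_def y_def)
  define h where "h = (\<lambda>i\<in>{..<r}. homology_class (n - 1) A (a i))"
  have h: "h \<in> carrier HAr"
    unfolding carrier_HAr h_def using a_cycle by (auto simp: carrier_reduced_homology_group)
  have "\<exists>b\<in>carrier (chain_group n A). (\<lambda>ws. a i ws - boundary (s (h i)) ws) = boundary b"
    if i: "i < r" for i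
  proof -
    have "homology_class (n - 1) A (a i) = homology_class (n - 1) A (boundary (s (h i)))"
      using s_class[OF in_HA[OF h i]] i by (simp add: h_def)
    then show ?thesis
      using homology_class_eq_iff[OF A_complex a_cycle s_cycle[OF in_HA[OF h i]]]
      by (auto simp: boundaries_def)
  qed
  then obtain b' where b': "\<And>i. i < r \<Longrightarrow> b' i \<in> carrier (chain_group n A)"
    "\<And>i. i < r \<Longrightarrow> (\<lambda>ws. a i ws - boundary (s (h i)) ws) = boundary (b' i)"
    by metis
  define b where "b i = (if i < r then b' i else (\<lambda>_. 0))" for i
  have b: "b i \<in> carrier (chain_group n A)" "b i \<in> carrier (chain_group n X)" for i
    using b'(1) chain_group_mono[OF A_subset] chain_group_zero by (auto simp: b_def)
  have b_boundary: "boundary (b i) ws = a i ws - boundary (s (h i)) ws" if "i < r" for i ws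
    using fun_cong[OF b'(2)[OF that], of ws] that by (simp add: b_def)
  \<comment> \<open>What has to be added to the base of \<open>c\<close> for the suspended cycle to have base \<open>y + (\<Sum>i<r. b i)\<close>.\<close>
  define t where "t = (\<lambda>ws. \<Sum>i<r. b i ws + s (h i) ws)"
  have bs: "(\<lambda>ws. b i ws + s (h i) ws) \<in> carrier (chain_group n X)" if "i < r" for i
    by (intro chain_group_add b s_chain in_HA h that)
  have t: "t \<in> carrier (chain_group n X)"
    unfolding t_def by (intro chain_group_sum bs)
  have "boundary t ws = (\<Sum>i<r. a i ws)" for ws
  proof -
    have "boundary t ws = (\<Sum>i<r. boundary (\<lambda>ws. b i ws + s (h i) ws) ws)"
      unfolding t_def by (subst boundary_chain_sum[of r _ n X]) (auto intro: bs)
    also have "\<dots> = (\<Sum>i<r. a i ws)"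
      by (intro sum.cong refl) (simp add: boundary_chain_add[of _ n X] b s_chain in_HA h b_boundary)
    finally show ?thesis .
  qed
  then have "boundary (\<lambda>ws. y ws + t ws) = (\<lambda>_. 0)"
    using sum_zero by (simp add: boundary_chain_add[OF y t])
  then have z: "(\<lambda>ws. y ws + t ws) \<in> carrier (cycle_group n X)" (is "?z \<in> _")
    using y t by (simp add: in_cycle_group chain_group_add)
  have b0: "b i = (\<lambda>_. 0)" if "\<not> i < r" for i
    using that by (simp add: b_def)
  have D: "boundary (join_chain (\<lambda>_. 0) b)
      = join_chain (\<lambda>ws. \<Sum>i<r. b i ws) (\<lambda>i ws. - boundary (b i) ws)"
    using boundary_join_chain[OF X A chain_group_zero[of "n + 1"], of r b] b(1) b0 by simp
  have DY: "join_chain (\<lambda>_. 0) b \<in> carrier (chain_group (n + 1) Y)"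
    using b(1) b0 by (intro join_chain_in_chain_group chain_group_zero) auto
  have diff: "(\<lambda>ys. suspended_cycle ?z h ys - c ys) = boundary (join_chain (\<lambda>_. 0) b)"
  proof (rule chain_join_eqI)
    show "(\<lambda>ys. suspended_cycle ?z h ys - c ys) \<in> carrier (chain_group n Y)"
      using chain_group_add[OF _ chain_group_uminus[OF cY]] suspended_cycle_in_cycle_group[OF z h]
      by (simp add: in_cycle_group)
    show "boundary (join_chain (\<lambda>_. 0) b) \<in> carrier (chain_group n Y)"
      using boundary_in_chain_group[OF Y_complex DY] by simp
    have "base_part (\<lambda>ys. suspended_cycle ?z h ys - c ys)
        = (\<lambda>ws. base_part (suspended_cycle ?z h) ws - y ws)"
      by (simp add: base_part_def y_def fun_eq_iff)
    also have "\<dots> = (\<lambda>ws. \<Sum>i<r. b i ws)"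
      by (simp add: suspended_cycle_def t_def sum.distrib)
    finally show "base_part (\<lambda>ys. suspended_cycle ?z h ys - c ys)
        = base_part (boundary (join_chain (\<lambda>_. 0) b))"
      by (simp add: D)
    show "link_part (\<lambda>ys. suspended_cycle ?z h ys - c ys) i
        = link_part (boundary (join_chain (\<lambda>_. 0) b)) i" if i: "i < r" for i
    proof -
      have "link_part (\<lambda>ys. suspended_cycle ?z h ys - c ys) i
          = (\<lambda>ws. link_part (suspended_cycle ?z h) i ws - a i ws)"
        by (simp add: link_part_def a_def fun_eq_iff)
      also have "\<dots> = (\<lambda>ws. - boundary (b i) ws)"
        using i by (simp add: suspended_cycle_def suspension_link_def b_boundary)
      finally show ?thesis by (simp add: D)
    qed
  qed
  have "homology_class n Y (suspended_cycle ?z h) = homology_class n Y c"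
    unfolding homology_class_eq_iff[OF Y_complex suspended_cycle_in_cycle_group[OF z h] c] diff
      boundaries_def
    using DY by blast
  then show ?thesis using that[OF z h] by simp
qed

text \<open>
  The isomorphism sends the class of \<open>z\<close> together with \<open>h\<close> to the class of the suspended cycle. It is
  assembled from two homomorphisms because only the first argument is a class whose representative has
  to be shown not to matter.
\<close>

lemma reduced_homology_join_iso:
  "reduced_homology_group n Y \<cong> reduced_homology_group n X \<times>\<times> HAr"
proof -
  let ?HX = "reduced_homology_group n X" and ?HY = "reduced_homology_group n Y"
  interpret HX: comm_group ?HX by (rule comm_group_reduced_homology_group[OF X])
  interpret HY: comm_group ?HY by (rule comm_group_reduced_homology_group[OF Y_complex])
  interpret Z: comm_group "cycle_group n X" by (rule comm_group_cycle_group[OF X])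
  interpret HAr: group HAr by (rule group_HAr)
  note one = HAr.one_closed and zero = cycle_group_zero[of n X]
  let ?class = "\<lambda>z h. homology_class n Y (suspended_cycle z h)"
  have in_HY: "?class z h \<in> carrier ?HY" if "z \<in> carrier (cycle_group n X)" "h \<in> carrier HAr" for z h
    using suspended_cycle_in_cycle_group[OF that] by (simp add: carrier_reduced_homology_group)
  have mult: "?class z h \<otimes>\<^bsub>?HY\<^esub> ?class z' h' = ?class (\<lambda>ws. z ws + z' ws) (h \<otimes>\<^bsub>HAr\<^esub> h')"
    if "z \<in> carrier (cycle_group n X)" "h \<in> carrier HAr" "z' \<in> carrier (cycle_group n X)" "h' \<in> carrier HAr"
    for z h z' h'
    using that
    by (simp only: homology_class_mult[OF Y_complex suspended_cycle_in_cycle_group suspended_cycle_in_cycle_group]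
        suspended_cycle_add)

  let ?f = "\<lambda>z. ?class z \<one>\<^bsub>HAr\<^esub>"
  have "?f \<in> hom (cycle_group n X) ?HY"
    using one by (intro homI) (simp_all add: in_HY mult del: one_sum_group mult_sum_group)
  then interpret f: group_hom "cycle_group n X" ?HY ?f
    by (simp add: group_hom_def group_hom_axioms_def Z.is_group HY.is_group)
  have "boundaries n X \<lhd> cycle_group n X"
    by (simp add: Z.normal_iff_subgroup subgroup_boundaries[OF X])
  moreover have "boundaries n X \<subseteq> kernel (cycle_group n X) ?HY ?f"
  proof
    fix z assume z: "z \<in> boundaries n X"
    then have zZ: "z \<in> carrier (cycle_group n X)"
      using subgroup.subset[OF subgroup_boundaries[OF X]] by blast
    have "?f z = \<one>\<^bsub>?HY\<^esub>"
      unfolding homology_class_eq_one_iff[OF Y_complex suspended_cycle_in_cycle_group[OF zZ one]]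
      by (rule suspended_cycle_of_boundary[OF z])
    then show "z \<in> kernel (cycle_group n X) ?HY ?f"
      using zZ by (simp add: kernel_def)
  qed
  ultimately obtain F where "F \<in> hom (cycle_group n X Mod boundaries n X) ?HY"
    "\<And>z. z \<in> carrier (cycle_group n X) \<Longrightarrow> F (boundaries n X #>\<^bsub>cycle_group n X\<^esub> z) = ?f z"
    by (rule f.FactGroup_universal_kernel) blast
  then have F: "F \<in> hom ?HX ?HY"
    "\<And>z. z \<in> carrier (cycle_group n X) \<Longrightarrow> F (homology_class n X z) = ?f z"
    by (simp_all add: reduced_homology_group_def homology_class_def)

  let ?g = "\<lambda>h. ?class (\<lambda>_. 0) h"
  have g: "?g \<in> hom HAr ?HY"
    using zero by (intro homI) (simp_all add: in_HY mult del: one_sum_group mult_sum_group)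

  let ?\<Phi> = "\<lambda>(p, h). F p \<otimes>\<^bsub>?HY\<^esub> ?g h"
  have \<Phi>_class: "?\<Phi> (homology_class n X z, h) = ?class z h"
    if "z \<in> carrier (cycle_group n X)" "h \<in> carrier HAr" for z h
    using that one zero by (simp add: F(2) mult del: one_sum_group mult_sum_group)
  have \<Phi>: "?\<Phi> \<in> hom (?HX \<times>\<times> HAr) ?HY"
  proof (rule homI)
    fix u assume u: "u \<in> carrier (?HX \<times>\<times> HAr)"
    then show "?\<Phi> u \<in> carrier ?HY"
      using hom_in_carrier[OF F(1)] hom_in_carrier[OF g] by auto
    fix v assume v: "v \<in> carrier (?HX \<times>\<times> HAr)"
    obtain p h p' h' where uv: "u = (p, h)" "v = (p', h')"
      by (metis surj_pair)
    have "F p \<in> carrier ?HY" "F p' \<in> carrier ?HY" "?g h \<in> carrier ?HY" "?g h' \<in> carrier ?HY"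
      using u v hom_in_carrier[OF F(1)] hom_in_carrier[OF g] by (auto simp: uv)
    then show "?\<Phi> (u \<otimes>\<^bsub>?HX \<times>\<times> HAr\<^esub> v) = ?\<Phi> u \<otimes>\<^bsub>?HY\<^esub> ?\<Phi> v"
      using u v hom_mult[OF F(1), of p p'] hom_mult[OF g, of h h']
      by (simp add: uv HY.m_ac del: mult_sum_group)
  qed
  have HXS: "group (?HX \<times>\<times> HAr)"
    by (rule DirProd_group) (rule HX.is_group, rule HAr.is_group)
  have "inj_on ?\<Phi> (carrier (?HX \<times>\<times> HAr))"
    unfolding inj_on_one_iff'[OF \<Phi> HXS HY.is_group]
  proof (intro allI impI)
    fix u assume u: "u \<in> carrier (?HX \<times>\<times> HAr)" "?\<Phi> u = \<one>\<^bsub>?HY\<^esub>"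
    then obtain z h where z: "z \<in> carrier (cycle_group n X)" "h \<in> carrier HAr"
      and u_eq: "u = (homology_class n X z, h)"
      by (auto simp: carrier_reduced_homology_group)
    have "?class z h = \<one>\<^bsub>?HY\<^esub>"
      using u(2) unfolding u_eq \<Phi>_class[OF z] .
    then have "suspended_cycle z h \<in> boundaries n Y"
      using homology_class_eq_one_iff[OF Y_complex suspended_cycle_in_cycle_group[OF z]] by blast
    from suspended_cycle_boundary_imp[OF z this] show "u = \<one>\<^bsub>?HX \<times>\<times> HAr\<^esub>"
      using homology_class_eq_one_iff[OF X z(1)] by (simp add: u_eq)
  qed
  moreover have "?\<Phi> ` carrier (?HX \<times>\<times> HAr) = carrier ?HY"
  proof
    show "?\<Phi> ` carrier (?HX \<times>\<times> HAr) \<subseteq> carrier ?HY"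
      using hom_in_carrier[OF \<Phi>] by (rule image_subsetI)
    show "carrier ?HY \<subseteq> ?\<Phi> ` carrier (?HX \<times>\<times> HAr)"
    proof
      fix q assume "q \<in> carrier ?HY"
      then obtain c where c: "c \<in> carrier (cycle_group n Y)" "q = homology_class n Y c"
        by (auto simp: carrier_reduced_homology_group)
      obtain z h where z: "z \<in> carrier (cycle_group n X)" "h \<in> carrier HAr" and "q = ?class z h"
        using homologous_suspended_cycle[OF c(1)] c(2) by metis
      then have "q = ?\<Phi> (homology_class n X z, h)"
        by (simp only: \<Phi>_class[OF z])
      moreover have "(homology_class n X z, h) \<in> carrier (?HX \<times>\<times> HAr)"
        using z by (simp add: carrier_reduced_homology_group)
      ultimately show "q \<in> ?\<Phi> ` carrier (?HX \<times>\<times> HAr)"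
        by (rule image_eqI)
    qed
  qed
  ultimately have "?\<Phi> \<in> iso (?HX \<times>\<times> HAr) ?HY"
    using \<Phi> by (simp add: iso_def bij_betw_def)
  then have "?HX \<times>\<times> HAr \<cong> ?HY"
    by (rule is_isoI)
  then show "?HY \<cong> ?HX \<times>\<times> HAr"
    by (rule group.iso_sym[OF HXS])
qed

end

theorem theorem2p4:
  fixes X A :: "'a set set" and r :: nat
  assumes "abstract_simplicial_complex X"
    and "subcomplex A X"
    and "r \<ge> 1"
    and "\<And>k::int. trivial_homomorphism (reduced_homology_group k A) (reduced_homology_group k X)
           (inclusion_induced k X)"
    and "\<And>k::int. free_abelian (reduced_homology_group k A)"
  shows "\<forall>n::int. reduced_homology_group n (join_over X A (discrete_complex r))
           \<cong> reduced_homology_group n X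
             \<times>\<times> sum_group {..<r} (\<lambda>_. reduced_homology_group (n - 1) A)"
proof
  fix n :: int
  obtain s where "s \<in> hom (reduced_homology_group (n - 1) A) (chain_group (n - 1 + 1) X)"
    "\<And>h. h \<in> carrier (reduced_homology_group (n - 1) A) \<Longrightarrow>
      boundary (s h) \<in> carrier (cycle_group (n - 1) A)"
    "\<And>h. h \<in> carrier (reduced_homology_group (n - 1) A) \<Longrightarrow>
      homology_class (n - 1) A (boundary (s h)) = h"
    using null_inclusion_section[OF assms(1,2,4,5)] by metis
  then interpret bounded_subcomplex_cycles X A n s r
    by unfold_locales (use assms in \<open>simp_all\<close>)
  show "reduced_homology_group n (join_over X A (discrete_complex r))
           \<cong> reduced_homology_group n X
             \<times>\<times> sum_group {..<r} (\<lambda>_. reduced_homology_group (n - 1) A)"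
    by (rule reduced_homology_join_iso)
qed

end
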